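(* Let $N\ge 3$ and let $P$ be a regular $N$-gon with side length $s$, centered at the origin, with vertices numbered clockwise and with a horizontal bottom edge (traversed from right to left). Let $m=\lfloor N/2\rfloor$ if $N$ is odd and $m=N/2-1$ if $N$ is even. Then: (1) $P$ has exactly $m$ star points on the extended horizontal forward edge. They are numbered outwards as $\mathrm{star}[1],\dots,\mathrm{star}[m]$, where $\mathrm{star}[1]$ is a vertex of $P$. (2) For each $k=1,\dots,m$, the points of the $k$-step region (the region between $\mathrm{star}[k]$ and $\mathrm{star}[k+1]$; for $k=m$, the region beyond $\mathrm{star}[m]$) whose orbit under the outer billiards map $\tau$ has constant step $k$ form a single convex polygon (tile) $S[k]$. The orbit of this tile is periodic of period $N$, i.e. $\tau^N(S[k])=S[k]$ (its minimal period may be a proper divisor of $N$). (3) For each $k$, the center of $S[k]$ is displaced horizontally outwards by $s/2$ from $\mathrm{star}[k]$; that is, the $x$-coordinate of the center of $S[k]$ equals the $x$-coordinate of $\mathrm{star}[k]$ minus $s/2$. (4) The centers of $S[1],\dots,S[m]$ all lie on the line through $\mathrm{star}[1]$ and the center $cD$ of $D=S[m]$. The $y$-coordinate of $cD$ equals the $y$-coordinate of the top vertex of $P$ if $N$ is odd, and equals $0$ (the $y$-coordinate of the center of $P$) if $N$ is even. Consequently the star points determine the centers of the $S[k]$.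
   Context: Let $c_1,\dots,c_N$ (indices mod $N$) be the vertices of $P$ in clockwise order. The edge from $c_i$ to $c_{i+1}$ has a forward extension, the open ray starting at $c_{i+1}$ in direction $c_{i+1}-c_i$, and a trailing extension, the open ray starting at $c_i$ in direction $c_i-c_{i+1}$. The outer billiards (tangent) map $\tau$ is defined off $P$ and off the trailing extensions by $\tau(p)=2c-p$, where $c$ is the support vertex of $p$. The support vertex is $c_j$ exactly when $p$ lies in the component of the complement of $P$ and all trailing extensions that is bounded by the trailing extension of the edge $c_{j-1}c_j$, the edge $c_{j-1}c_j$ itself, and the trailing extension of the edge $c_jc_{j+1}$. The inverse $\tau^{-1}$ is defined off $P$ and off the forward extensions by $\tau^{-1}(p)=2c_j-p$ for $p$ in the component bounded by the forward extension of $c_{j-1}c_j$, the edge $c_jc_{j+1}$, and the forward extension of $c_jc_{j+1}$. Let $v=c_j$ be the left endpoint of the horizontal bottom edge $c_{j-1}c_j$, so that the forward extension of this edge is the horizontal ray going left from $v$. The star points are the points at which the extended trailing edges of $P$ (each trailing extension taken together with its starting vertex) meet this extended forward edge (taken together with its endpoint $v$). They are numbered starting with $\mathrm{star}[1]=v$ and moving outwards (to the left). Consider the component $U$ of the domain of $\tau^{-1}$ on which $\tau^{-1}(p)=2v-p$; it is bounded below by the horizontal forward extension. The trailing extensions partition $U$ into regions, and the $k$-step region is the one between $\mathrm{star}[k]$ and $\mathrm{star}[k+1]$. It consists of the points of $U$ whose support vertex under $\tau$ is $c_{j+k}$, i.e. is $k$ vertices further (clockwise) than $v=c_j$. A point $p$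 of the $k$-step region has constant step $k$ if for every $n\ge 0$ the point $\tau^n(p)$ is in the domain of $\tau$ and has support vertex $c_{j+(n+1)k}$, i.e. the orbit advances $k$ vertices on every iteration. *)

theory Defs
  imports "HOL-Analysis.Analysis"
begin

text \<open>The plane is \<^typ>\<open>complex\<close>, with \<open>Re\<close> and \<open>Im\<close> as the two coordinates. The vertices of an
  N-gon are given by a family \<open>c\<close> indexed by all integers; for a regular N-gon the
  recurrence below makes the family N-periodic, so indices are effectively taken mod N.
  The i-th edge runs from \<open>c i\<close> to \<open>c (i + 1)\<close>.\<close>

definition regular_polygon :: "nat \<Rightarrow> real \<Rightarrow> (int \<Rightarrow> complex) \<Rightarrow> bool" where
  "regular_polygon N s c \<longleftrightarrow>
     (\<forall>i. c (i + 1) = cis (- (2 * pi / real N)) * c i) \<and> (\<forall>i. dist (c i) (c (i + 1)) = s)"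

definition horizontal_bottom_edge :: "(int \<Rightarrow> complex) \<Rightarrow> int \<Rightarrow> bool" where
  "horizontal_bottom_edge c i \<longleftrightarrow>
     Im (c i) = Im (c (i + 1)) \<and> Re (c (i + 1)) < Re (c i) \<and> (\<forall>l. Im (c i) \<le> Im (c l))"

definition polygon :: "(int \<Rightarrow> complex) \<Rightarrow> complex set" where
  "polygon c = convex hull (range c)"

definition forward_ext :: "(int \<Rightarrow> complex) \<Rightarrow> int \<Rightarrow> complex set" where
  "forward_ext c i = {c (i + 1) + t *\<^sub>R (c (i + 1) - c i) | t. t > 0}"

definition trailing_ext :: "(int \<Rightarrow> complex) \<Rightarrow> int \<Rightarrow> complex set" where
  "trailing_ext c i = {c i + t *\<^sub>R (c i - c (i + 1)) | t. t > 0}"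

definition tau_domain :: "(int \<Rightarrow> complex) \<Rightarrow> complex set" where
  "tau_domain c = - (polygon c \<union> (\<Union>i. trailing_ext c i))"

definition tau_inv_domain :: "(int \<Rightarrow> complex) \<Rightarrow> complex set" where
  "tau_inv_domain c = - (polygon c \<union> (\<Union>i. forward_ext c i))"

text \<open>A component is "bounded by" two extensions and an edge when its topological frontier is
  their union; the closed edge contains the starting points of both (open) extensions.\<close>

definition has_support :: "(int \<Rightarrow> complex) \<Rightarrow> complex \<Rightarrow> int \<Rightarrow> bool" where
  "has_support c p i \<longleftrightarrow>
     (\<exists>C \<in> components (tau_domain c). p \<in> C \<and>
        frontier C = trailing_ext c (i - 1) \<union> closed_segment (c (i - 1)) (c i) \<union> trailing_ext c i)"

definition has_inv_support :: "(int \<Rightarrow> complex) \<Rightarrow> complex \<Rightarrow> int \<Rightarrow> bool" where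
  "has_inv_support c p i \<longleftrightarrow>
     (\<exists>C \<in> components (tau_inv_domain c). p \<in> C \<and>
        frontier C = forward_ext c (i - 1) \<union> closed_segment (c i) (c (i + 1)) \<union> forward_ext c i)"

definition support_vertex :: "(int \<Rightarrow> complex) \<Rightarrow> complex \<Rightarrow> complex" where
  "support_vertex c p = (THE v. \<exists>i. has_support c p i \<and> v = c i)"

text \<open>The value of \<open>tau c\<close> is meaningful on \<open>tau_domain c\<close> only.\<close>

definition tau :: "(int \<Rightarrow> complex) \<Rightarrow> complex \<Rightarrow> complex" where
  "tau c p = 2 * support_vertex c p - p"

text \<open>In the following definitions \<open>j\<close> is the index of the left endpoint \<open>v = c j\<close> of the
  horizontal bottom edge.\<close>

definition extended_forward_edge :: "(int \<Rightarrow> complex) \<Rightarrow> int \<Rightarrow> complex set" where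
  "extended_forward_edge c j = insert (c j) (forward_ext c (j - 1))"

definition star_points :: "(int \<Rightarrow> complex) \<Rightarrow> int \<Rightarrow> complex set" where
  "star_points c j =
     extended_forward_edge c j \<inter> (\<Union>i. insert (c i) (trailing_ext c i))"

text \<open>The component of the domain of the inverse map on which the inverse is \<open>p \<mapsto> 2 * c j - p\<close>.\<close>

definition inv_component :: "(int \<Rightarrow> complex) \<Rightarrow> int \<Rightarrow> complex set" where
  "inv_component c j = {p. has_inv_support c p j}"

definition step_region :: "(int \<Rightarrow> complex) \<Rightarrow> int \<Rightarrow> nat \<Rightarrow> complex set" where
  "step_region c j k = {p \<in> inv_component c j. has_support c p (j + int k)}"

definition constant_step :: "(int \<Rightarrow> complex) \<Rightarrow> int \<Rightarrow> nat \<Rightarrow> complex \<Rightarrow> bool" where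
  "constant_step c j k p \<longleftrightarrow>
     (\<forall>n. (tau c ^^ n) p \<in> tau_domain c \<and>
          has_support c ((tau c ^^ n) p) (j + (int n + 1) * int k))"

definition tile :: "(int \<Rightarrow> complex) \<Rightarrow> int \<Rightarrow> nat \<Rightarrow> complex set" where
  "tile c j k = {p \<in> step_region c j k. constant_step c j k p}"

text \<open>Since \<open>tau\<close> is undefined on the trailing extensions, tiles are open: they are
  interiors of polygons.\<close>

definition open_convex_polygon :: "complex set \<Rightarrow> bool" where
  "open_convex_polygon X \<longleftrightarrow> X \<noteq> {} \<and> (\<exists>Q. polytope Q \<and> X = interior Q)"

definition polygon_vertices :: "complex set \<Rightarrow> complex set" where
  "polygon_vertices X = {x. x extreme_point_of (closure X)}"

text \<open>The center of a polygon is the mean of its vertices. A polygon with a nontrivial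
  rotational symmetry has it as its unique center of rotation.\<close>

definition center :: "complex set \<Rightarrow> complex" where
  "center X = (\<Sum>x \<in> polygon_vertices X. x) / of_nat (card (polygon_vertices X))"

definition top_vertex :: "(int \<Rightarrow> complex) \<Rightarrow> complex \<Rightarrow> bool" where
  "top_vertex c t \<longleftrightarrow> t \<in> range c \<and> (\<forall>x \<in> range c - {t}. Im x < Im t)"

end

theory Submission
  imports Defs
begin

text \<open>Write \<open>\<alpha> = \<pi> / N\<close>, let \<open>R\<close> be the circumradius and \<open>a = R * cos \<alpha>\<close> the inradius. The signed distance
  of a point from the line of the \<open>i\<close>-th edge is a cosine sampled at the angles \<open>2 * \<alpha> * i\<close>, so the edges
  visible from a point outside the polygon form one cyclic interval (\<open>exit_side_unique\<close>). The point
  has support vertex \<open>c i\<close> when the interval ends with the edge \<open>i - 1\<close> and the point is not on the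
  line of the edge \<open>i\<close>. This turns the components of the domain of \<^const>\<open>tau\<close> into convex sectors given by
  two linear inequalities (\<open>has_support_iff\<close>), and, by reversing the numbering, those of the inverse
  (\<open>has_inv_support_iff\<close>).

  Let \<open>w\<close> be the rotation by \<open>k\<close> vertices and \<open>q\<close> the point with \<open>2 * c (j + k) - q = w * q\<close>. By symmetry
  the orbit of \<open>q\<close> is \<open>w ^ n * q\<close>. A point \<open>q + d\<close> with the same support vertices has the orbit
  \<open>w ^ n * q + (- 1) ^ n * d\<close>. Turned back by \<open>w ^ n\<close>, the condition of constant step says that all
  rotations of \<open>d\<close> by powers of \<open>- cnj w\<close> keep the point in one sector (\<open>constant_step_iff\<close>). Since \<open>q\<close>
  is equidistant from the two sides of that sector, these are half-planes tangent to one circle about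
  \<open>q\<close>, invariant under a rotation of finite order at least 3. Hence the tile is an open polygon with
  center \<open>q\<close>, and after \<open>N\<close> steps it returns to itself (\<open>rotation_invariant_polygon\<close>, \<open>tile_polygon\<close>).

  The rest is trigonometry with \<open>t = tan (\<alpha> * k)\<close>: the \<open>k\<close>-th star point is \<open>(- a * t, - a)\<close>, and
  \<open>q = (- s / 2 - a * t, - a + s / 2 * t)\<close>. The first coordinates give the displacement by \<open>s / 2\<close>, and
  as \<open>t\<close> varies the centers run along a line through the first star point (\<open>star_points_eq\<close>,
  \<open>closure_step_region_edge\<close>, \<open>centers_line\<close>).\<close>

section \<open>Intersections of open half-planes\<close>

text \<open>Moving a boundary point a little towards the interior point \<open>s\<close> makes all inequalities strict,
  whether there are finitely many of them or not.\<close>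

lemma closure_open_halfspaces:
  fixes v :: "'i \<Rightarrow> 'a::real_inner"
  assumes "\<forall>i\<in>I. inner (v i) s < b i"
  shows "closure {x. \<forall>i\<in>I. inner (v i) x < b i} = {x. \<forall>i\<in>I. inner (v i) x \<le> b i}"
    (is "closure ?S = ?T")
proof
  have "?T = (\<Inter>i\<in>I. {x. inner (v i) x \<le> b i})" by auto
  then have "closed ?T" by (auto intro!: closed_INT closed_halfspace_le)
  then show "closure ?S \<subseteq> ?T" by (intro closure_minimal) (auto simp: less_imp_le)
  show "?T \<subseteq> closure ?S"
  proof
    fix x assume x: "x \<in> ?T"
    define f where "f n = x + inverse (real (Suc n)) *\<^sub>R (s - x)" for n
    have "f n \<in> ?S" for n
    proof safe
      fix i assume i: "i \<in> I"
      let ?t = "inverse (real (Suc n))"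
      have t: "0 < ?t" "?t \<le> 1" by (auto simp: field_simps)
      have "inner (v i) (f n) = (1 - ?t) * inner (v i) x + ?t * inner (v i) s"
        unfolding f_def by (simp add: inner_add_right inner_diff_right algebra_simps)
      also have "\<dots> < (1 - ?t) * b i + ?t * b i"
        using x assms i t by (intro add_le_less_mono mult_left_mono mult_strict_left_mono) auto
      finally show "inner (v i) (f n) < b i" by (simp add: algebra_simps)
    qed
    moreover have "f \<longlonglongrightarrow> x + 0 *\<^sub>R (s - x)"
      unfolding f_def by (intro tendsto_intros LIMSEQ_inverse_real_of_nat)
    ultimately show "x \<in> closure ?S" by (auto simp: closure_sequential)
  qed
qed

text \<open>A connected set meeting an open piece cannot leave it, because the union of the remaining pieces
  is open as well.\<close>

lemma components_of_disjoint_open_cover: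
  fixes X :: "'a::topological_space set"
  assumes cover: "X = \<Union>\<F>" and op: "\<And>T. T \<in> \<F> \<Longrightarrow> open T"
    and conn: "\<And>T. T \<in> \<F> \<Longrightarrow> connected T"
    and disj: "\<And>S T. S \<in> \<F> \<Longrightarrow> T \<in> \<F> \<Longrightarrow> S \<noteq> T \<Longrightarrow> S \<inter> T = {}"
  shows "components X = \<F> - {{}}"
proof -
  have comp: "T \<in> components X" if T: "T \<in> \<F>" "T \<noteq> {}" for T
    unfolding in_components_maximal
  proof (intro conjI allI impI)
    show "T \<noteq> {}" "T \<subseteq> X" "connected T" using T cover conn by auto
    fix D assume D: "D \<noteq> {} \<and> T \<subseteq> D \<and> D \<subseteq> X \<and> connected D"
    let ?B = "\<Union>(\<F> - {T})"
    have "open T" "open ?B" using op T by auto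
    moreover have sub: "D \<subseteq> T \<union> ?B" using D cover by auto
    moreover have "T \<inter> ?B \<inter> D = {}" using disj T by auto
    ultimately have "T \<inter> D = {} \<or> ?B \<inter> D = {}" using D by (intro connectedD) auto
    moreover have "T \<inter> D \<noteq> {}" using D T by auto
    ultimately have "?B \<inter> D = {}" by simp
    then have "D \<subseteq> T" using sub by blast
    then show "D = T" using D by simp
  qed
  show ?thesis
  proof
    show "\<F> - {{}} \<subseteq> components X" using comp by blast
    show "components X \<subseteq> \<F> - {{}}"
    proof
      fix C assume C: "C \<in> components X"
      then obtain x where x: "x \<in> C" using in_components_nonempty by blast
      then obtain T where T: "T \<in> \<F>" "x \<in> T" using in_components_subset[OF C] cover by auto
      then have "T \<in> components X" using comp by auto
      then have "C = T" using components_eq C x T by blast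
      then show "C \<in> \<F> - {{}}" using T by auto
    qed
  qed
qed

section \<open>Sides and sectors of a regular polygon\<close>

lemma inner_cis: "inner (cis x) (cis y) = cos (x - y)"
  by (simp add: inner_complex_def cos_diff)

lemma inner_mult_unit: "norm w = 1 \<Longrightarrow> inner (w * x) (w * y) = inner x (y :: complex)"
proof -
  assume w: "norm w = 1"
  have "inner (w * x) (w * y) = ((Re w)\<^sup>2 + (Im w)\<^sup>2) * inner x y"
    by (simp add: inner_complex_def power2_eq_square algebra_simps)
  then show ?thesis using w by (simp add: cmod_def)
qed

lemma sum_powers_root_of_unity:
  fixes w :: "'a::field" assumes "w ^ M = 1" "w \<noteq> 1" shows "(\<Sum>n<M. w ^ n) = 0"
  using assms by (simp add: geometric_sum)

text \<open>Both orientations, \<open>\<alpha> = \<pi> / N\<close> and \<open>\<alpha> = - \<pi> / N\<close>, are admitted: reversing the numbering of the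
  vertices exchanges trailing and forward extensions, so the results on support vertices apply to
  the inverse map too.\<close>

locale regular_vertices =
  fixes N :: nat and R \<theta> \<alpha> :: real and c :: "int \<Rightarrow> complex"
  assumes N: "3 \<le> N" and R: "0 < R" and alpha: "\<bar>\<alpha>\<bar> = pi / real N"
    and c_eq: "c i = of_real R * cis (\<theta> - 2 * \<alpha> * of_int i)"
begin

text \<open>The outward unit normal of the edge from \<open>c i\<close> to \<open>c (i + 1)\<close>.\<close>

definition normal :: "int \<Rightarrow> complex" where
  "normal i = cis (\<theta> - 2 * \<alpha> * of_int i - \<alpha>)"

text \<open>The signed distance from the line of the \<open>i\<close>-th edge; \<open>R * cos \<alpha>\<close> is the radius of the incircle.\<close>

definition side :: "int \<Rightarrow> complex \<Rightarrow> real" where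
  "side i p = inner (normal i) p - R * cos \<alpha>"

text \<open>The edge \<open>i - 1\<close> is visible from these points and the edge \<open>i\<close> is not. They will turn out to be
  the points with support vertex \<open>c i\<close>.\<close>

definition sector :: "int \<Rightarrow> complex set" where
  "sector i = {p. side (i - 1) p > 0 \<and> side i p < 0}"

text \<open>Stated for a product, so that the sign of \<open>\<alpha>\<close> cancels.\<close>

lemma sin_alpha_prod_nonneg:
  assumes "0 \<le> x" "x \<le> real N" "0 \<le> y" "y \<le> real N"
  shows "sin (\<alpha> * x) * sin (\<alpha> * y) \<ge> 0"
proof -
  have *: "0 \<le> sin (\<bar>\<alpha>\<bar> * t)" if "0 \<le> t" "t \<le> real N" for t
  proof (rule sin_ge_zero)
    show "0 \<le> \<bar>\<alpha>\<bar> * t" using that by simp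
    have "\<bar>\<alpha>\<bar> * t \<le> \<bar>\<alpha>\<bar> * real N" using that by (intro mult_left_mono) auto
    also have "\<dots> = pi" using alpha N by simp
    finally show "\<bar>\<alpha>\<bar> * t \<le> pi" .
  qed
  have "sin (\<alpha> * x) * sin (\<alpha> * y) = sin (\<bar>\<alpha>\<bar> * x) * sin (\<bar>\<alpha>\<bar> * y)"
    by (cases "\<alpha> \<ge> 0") auto
  then show ?thesis using *[of x] *[of y] assms by simp
qed

lemma alpha_bound: "0 < \<bar>\<alpha>\<bar>" "\<bar>\<alpha>\<bar> \<le> pi / 3"
proof -
  show "0 < \<bar>\<alpha>\<bar>" using alpha N by simp
  show "\<bar>\<alpha>\<bar> \<le> pi / 3" unfolding alpha using N by (intro divide_left_mono) auto
qed

lemma cos_alpha_pos: "cos \<alpha> > 0"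
  using alpha_bound cos_gt_zero_pi[of "\<alpha>"] pi_gt_zero by linarith

lemma sin_alpha_nz: "sin \<alpha> \<noteq> 0"
proof -
  have "sin \<bar>\<alpha>\<bar> > 0" using alpha_bound pi_gt_zero by (intro sin_gt_zero) linarith+
  then show ?thesis by (cases "\<alpha> \<ge> 0") auto
qed

lemma two_alpha_N: "cis (2 * \<alpha> * real N * of_int z) = 1"
proof -
  have "\<alpha> * real N = pi \<or> \<alpha> * real N = - pi"
    using alpha N by (auto simp: abs_if field_simps split: if_splits)
  then have "2 * \<alpha> * real N * of_int z = 2 * pi * of_int z \<or>
      2 * \<alpha> * real N * of_int z = 2 * pi * of_int (- z)"
    by (metis mult.assoc mult_minus_left mult_minus_right of_int_minus)
  then show ?thesis using cis_multiple_2pi[of "of_int z"] cis_multiple_2pi[of "of_int (- z)"]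
    by (metis Ints_of_int)
qed

lemma normal_add: "normal (i + l) = cis (- 2 * \<alpha> * of_int l) * normal i"
  by (simp add: normal_def cis_mult algebra_simps)

lemma c_add: "c (i + l) = cis (- 2 * \<alpha> * of_int l) * c i"
  by (simp add: c_eq cis_mult algebra_simps)

lemma cis_period: "cis (- 2 * \<alpha> * of_int (int N * z)) = 1"
  using two_alpha_N[of "- z"] by (simp add: algebra_simps)

lemma normal_periodic: "normal (i + int N * z) = normal i"
  by (simp only: normal_add cis_period mult_1)

lemma c_periodic: "c (i + int N * z) = c i"
  by (simp only: c_add cis_period mult_1)

lemma side_periodic: "side (i + int N * z) = side i"
  by (simp add: side_def normal_periodic fun_eq_iff)

lemma sector_periodic: "sector (i + int N * z) = sector i"
proof -
  have "i + int N * z - 1 = (i - 1) + int N * z" by simp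
  then show ?thesis unfolding sector_def by (metis side_periodic)
qed

lemma norm_normal: "norm (normal i) = 1"
  by (simp add: normal_def)

lemma side_vertex: "side i (c (i + l)) = - 2 * R * sin (\<alpha> * of_int l) * sin (\<alpha> * (of_int l - 1))"
proof -
  have "inner (normal i) (c (i + l)) = R * inner (normal i) (cis (\<theta> - 2 * \<alpha> * of_int (i + l)))"
    by (simp add: c_eq inner_complex_def algebra_simps)
  also have "\<dots> = R * cos (\<alpha> * (2 * of_int l - 1))"
    by (simp add: normal_def inner_cis algebra_simps)
  finally have "side i (c (i + l)) = - R * (cos \<alpha> - cos (\<alpha> * (2 * of_int l - 1)))"
    by (simp add: side_def algebra_simps)
  also have "cos \<alpha> - cos (\<alpha> * (2 * of_int l - 1)) = 2 * sin (\<alpha> * of_int l) * sin (\<alpha> * (of_int l - 1))"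
  proof -
    have "(\<alpha> + \<alpha> * (2 * of_int l - 1)) / 2 = \<alpha> * of_int l"
      "(\<alpha> * (2 * of_int l - 1) - \<alpha>) / 2 = \<alpha> * (of_int l - 1)"
      by (simp_all add: field_simps)
    then show ?thesis using cos_diff_cos[of \<alpha> "\<alpha> * (2 * of_int l - 1)"] by simp
  qed
  finally show ?thesis by simp
qed

lemma side_vertex_same [simp]: "side i (c i) = 0" "side i (c (i + 1)) = 0" "side (i - 1) (c i) = 0"
  using side_vertex[of i 0] side_vertex[of i 1] side_vertex[of "i - 1" 1] by simp_all

lemma side_vertex_neg: "side (i - 1) (c (i + 1)) < 0" "side i (c (i - 1)) < 0"
proof -
  have "sin (2 * \<alpha>) * sin \<alpha> = 2 * (sin \<alpha>)\<^sup>2 * cos \<alpha>"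
    by (simp add: sin_double power2_eq_square)
  then have *: "R * (sin (2 * \<alpha>) * sin \<alpha>) > 0" using sin_alpha_nz cos_alpha_pos R by simp
  show "side (i - 1) (c (i + 1)) < 0"
    using side_vertex[of "i - 1" 2] * by (simp add: algebra_simps)
  show "side i (c (i - 1)) < 0"
    using side_vertex[of i "-1"] * by (simp add: algebra_simps)
qed

lemma side_vertex_le: "side i (c l) \<le> 0"
proof -
  define d where "d = (l - i) mod int N"
  have d: "0 \<le> d" "d < int N" using N by (auto simp: d_def)
  have "l = (i + d) + int N * ((l - i) div int N)"
    unfolding d_def by (simp add: algebra_simps)
  then have cl: "c l = c (i + d)" by (metis c_periodic)
  show ?thesis
  proof (cases "d = 0")
    case False
    then have "0 \<le> sin (\<alpha> * of_int d) * sin (\<alpha> * (of_int d - 1))"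
      using d by (intro sin_alpha_prod_nonneg) auto
    then show ?thesis unfolding cl side_vertex using R by (simp add: mult_nonneg_nonneg mult.assoc)
  qed (simp add: cl)
qed

lemma side_affine: "side i (x + t *\<^sub>R (y - z)) = side i x + t * (side i y - side i z)"
  by (simp add: side_def inner_add_right inner_diff_right algebra_simps)

lemma vertices_sum_zero: "(\<Sum>n<N. cis (- 2 * \<alpha> * real n)) = 0"
proof -
  let ?w = "cis (- 2 * \<alpha>)"
  have "?w ^ N = 1" using cis_period[of 1] by (simp add: Complex.DeMoivre mult.commute mult.left_commute)
  moreover have "?w \<noteq> 1"
  proof
    assume "?w = 1"
    then have "cos (2 * \<alpha>) = 1" by (simp add: complex_eq_iff)
    then show False using sin_alpha_nz by (simp add: cos_double_sin)
  qed
  moreover have "cis (- 2 * \<alpha> * real n) = ?w ^ n" for n by (simp add: Complex.DeMoivre mult.commute)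
  ultimately show ?thesis by (simp add: sum_powers_root_of_unity)
qed

lemma zero_in_polygon: "0 \<in> polygon c"
proof -
  have "(\<Sum>n<N. (1 / real N) *\<^sub>R c (int n)) \<in> convex hull range c"
    using N by (intro convex_sum) (auto intro: hull_inc)
  moreover have "c (int n) = cis (- 2 * \<alpha> * real n) * c 0" for n using c_add[of 0 "int n"] by simp
  then have "(\<Sum>n<N. (1 / real N) *\<^sub>R c (int n)) = 0"
    using vertices_sum_zero by (simp flip: scaleR_sum_right sum_distrib_right)
  ultimately show ?thesis by (simp add: polygon_def)
qed

lemma ex_int_maximum:
  fixes f :: "int \<Rightarrow> real"
  assumes "\<And>i. f (i + int N) = f i"
  shows "\<exists>i. \<forall>l. f l \<le> f i"
proof -
  have per: "f (i + int N * z) = f i" for i z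
  proof (induction z rule: int_induct[where k=0])
    case (step1 z) then show ?case using assms[of "i + int N * z"] by (simp add: algebra_simps)
  next
    case (step2 z) then show ?case using assms[of "i + int N * (z - 1)"] by (simp add: algebra_simps)
  qed simp
  let ?A = "f ` {0..<int N}"
  have "Max ?A \<in> ?A" using N by (intro Max_in) auto
  then obtain i where i: "Max ?A = f i" by auto
  have "f l \<le> f i" for l
  proof -
    have "l = l mod int N + int N * (l div int N)" by simp
    then have "f l = f (l mod int N)" by (metis per)
    moreover have "f (l mod int N) \<le> Max ?A" using N by (intro Max_ge) auto
    ultimately show ?thesis using i by simp
  qed
  then show ?thesis by blast
qed

text \<open>For the inclusion that is not a matter of convex hulls, let \<open>i\<close> be the edge whose line has the
  largest signed distance from \<open>p\<close>. Comparison with the two neighbouring edges shows that \<open>p\<close> lies in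
  the cone spanned by \<open>c i\<close> and \<open>c (i + 1)\<close>, and \<open>side i p \<le> 0\<close> cuts this cone down to the triangle
  with apex 0, which is part of the hull.\<close>

lemma polygon_eq: "polygon c = {p. \<forall>i. side i p \<le> 0}"
proof
  have "convex {p. \<forall>i. side i p \<le> 0}"
  proof -
    have "{p. \<forall>i. side i p \<le> 0} = (\<Inter>i. {p. inner (normal i) p \<le> R * cos \<alpha>})"
      by (auto simp: side_def)
    then show ?thesis by (auto intro!: convex_INT convex_halfspace_le)
  qed
  then show "polygon c \<subseteq> {p. \<forall>i. side i p \<le> 0}"
    unfolding polygon_def by (intro hull_minimal) (auto simp: side_vertex_le)
  show "{p. \<forall>i. side i p \<le> 0} \<subseteq> polygon c"
  proof
    fix p assume p: "p \<in> {p. \<forall>i. side i p \<le> 0}"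
    have "\<exists>i. \<forall>l. inner (normal l) p \<le> inner (normal i) p"
      using normal_periodic[of _ 1] by (intro ex_int_maximum) simp
    then obtain i where i: "\<And>l. inner (normal l) p \<le> inner (normal i) p" by blast
    define z where "z = p / normal i"
    have nz: "normal i \<noteq> 0" using norm_normal[of i] by force
    have pz: "p = normal i * z" using nz by (simp add: z_def)
    have inn: "inner (normal (i + l)) p = Re z * cos (2 * \<alpha> * of_int l) - Im z * sin (2 * \<alpha> * of_int l)" for l
    proof -
      have "inner (normal (i + l)) p = inner (cis (- 2 * \<alpha> * of_int l)) z"
        unfolding pz normal_add mult.commute[of _ "normal i"]
        by (rule inner_mult_unit) (rule norm_normal)
      then show ?thesis by (simp add: inner_complex_def algebra_simps)
    qed
    have ineq: "\<bar>Im z\<bar> * \<bar>sin \<alpha>\<bar> * cos \<alpha> \<le> Re z * (sin \<alpha>)\<^sup>2"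
    proof -
      have "Re z * cos (2 * \<alpha>) - Im z * sin (2 * \<alpha>) \<le> Re z"
        "Re z * cos (2 * \<alpha>) + Im z * sin (2 * \<alpha>) \<le> Re z"
        using i[of "i + 1"] i[of "i + -1"] inn[of 0] inn[of 1] inn[of "-1"] by auto
      then have "\<bar>Im z * (2 * sin \<alpha> * cos \<alpha>)\<bar> \<le> 2 * (Re z * (sin \<alpha>)\<^sup>2)"
        unfolding cos_double_sin sin_double by (simp add: algebra_simps abs_le_iff)
      then show ?thesis using cos_alpha_pos by (simp add: abs_mult)
    qed
    \<comment> \<open>In the basis \<open>c i\<close>, \<open>c (i + 1)\<close> the point has the coordinates \<open>(X + Y) / 2\<close> and \<open>(X - Y) / 2\<close>.\<close>
    define X where "X = Re z / (R * cos \<alpha>)"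
    define Y where "Y = Im z / (R * sin \<alpha>)"
    have XY: "\<bar>Y\<bar> \<le> X"
    proof -
      have "(\<bar>Im z\<bar> * cos \<alpha>) * \<bar>sin \<alpha>\<bar> \<le> (Re z * \<bar>sin \<alpha>\<bar>) * \<bar>sin \<alpha>\<bar>"
        using ineq by (simp only: power2_eq_square abs_mult_self_eq mult_ac)
      then have "\<bar>Im z\<bar> * cos \<alpha> \<le> Re z * \<bar>sin \<alpha>\<bar>"
        using sin_alpha_nz by (simp only: mult_le_cancel_right)
      then have "\<bar>Im z\<bar> / \<bar>sin \<alpha>\<bar> \<le> Re z / cos \<alpha>"
        using sin_alpha_nz cos_alpha_pos by (simp add: pos_divide_le_eq pos_le_divide_eq)
      then have "\<bar>Im z\<bar> / \<bar>sin \<alpha>\<bar> / R \<le> Re z / cos \<alpha> / R"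
        using R by (intro divide_right_mono) auto
      then show ?thesis unfolding X_def Y_def using R by (simp add: abs_mult mult.commute)
    qed
    have X1: "X \<le> 1"
    proof -
      have "side i p \<le> 0" using p by auto
      then have "Re z \<le> R * cos \<alpha>" using inn[of 0] by (simp add: side_def)
      then show ?thesis using R cos_alpha_pos by (simp add: X_def)
    qed
    have cn: "c i = normal i * (R * cis \<alpha>)" "c (i + 1) = normal i * (R * cis (- \<alpha>))"
      by (simp_all add: c_eq normal_def cis_mult algebra_simps)
    have z: "z = (((X + Y) / 2) *\<^sub>R (R * cis \<alpha>) + ((X - Y) / 2) *\<^sub>R (R * cis (- \<alpha>)))"
    proof -
      have "X * (R * cos \<alpha>) = Re z" "Y * (R * sin \<alpha>) = Im z"
        using R cos_alpha_pos sin_alpha_nz by (simp_all add: X_def Y_def)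
      then show ?thesis by (simp add: complex_eq_iff algebra_simps add_divide_distrib diff_divide_distrib)
    qed
    have verts: "c i \<in> polygon c" "c (i + 1) \<in> polygon c"
      by (auto simp: polygon_def intro: hull_inc)
    have conv: "convex (polygon c)" by (simp add: polygon_def)
    show "p \<in> polygon c"
    proof (cases "X = 0")
      case True
      then show ?thesis using zero_in_polygon XY z pz by simp
    next
      case False
      then have X0: "X > 0" using XY by linarith
      define q where "q = ((X + Y) / (2 * X)) *\<^sub>R c i + ((X - Y) / (2 * X)) *\<^sub>R c (i + 1)"
      have "(X + Y) / (2 * X) + (X - Y) / (2 * X) = 1"
        using X0 by (simp flip: add_divide_distrib)
      moreover have "0 \<le> (X + Y) / (2 * X)" "0 \<le> (X - Y) / (2 * X)"
        using XY X0 by (auto intro!: divide_nonneg_pos)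
      ultimately have "q \<in> polygon c"
        unfolding q_def using verts by (intro convexD[OF conv])
      then have "X *\<^sub>R q + (1 - X) *\<^sub>R 0 \<in> polygon c"
        using X0 X1 zero_in_polygon by (intro convexD[OF conv]) auto
      also have "X *\<^sub>R q + (1 - X) *\<^sub>R 0 = ((X + Y) / 2) *\<^sub>R c i + ((X - Y) / 2) *\<^sub>R c (i + 1)"
        using X0 by (simp add: q_def scaleR_right_distrib)
      also have "\<dots> = normal i * (((X + Y) / 2) *\<^sub>R (R * cis \<alpha>) + ((X - Y) / 2) *\<^sub>R (R * cis (- \<alpha>)))"
        unfolding cn by (simp only: distrib_left mult_scaleR_right)
      also have "\<dots> = p" using z pz by simp
      finally show ?thesis .
    qed
  qed
qed

section \<open>Supports\<close>

text \<open>As a function of the edge, the signed distance is a sampled cosine; this is what makes the visible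
  edges a cyclic interval.\<close>

lemma side_polar: "\<exists>\<rho> \<psi>. \<forall>i. side i p = \<rho> * cos (\<psi> + 2 * \<alpha> * of_int i) - R * cos \<alpha>"
proof -
  obtain \<rho> \<phi> where p: "p = rcis \<rho> \<phi>" using rcis_Ex by blast
  have "side i p = \<rho> * cos ((\<phi> + \<alpha> - \<theta>) + 2 * \<alpha> * of_int i) - R * cos \<alpha>" for i
  proof -
    have "inner (normal i) p = \<rho> * inner (cis \<phi>) (normal i)"
      by (simp add: p rcis_def inner_complex_def algebra_simps)
    also have "\<dots> = \<rho> * cos ((\<phi> + \<alpha> - \<theta>) + 2 * \<alpha> * of_int i)"
      unfolding normal_def inner_cis by (simp add: algebra_simps)
    finally show ?thesis by (simp add: side_def)
  qed
  then show ?thesis by blast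
qed

text \<open>Two places modulo \<open>N\<close> where visibility ends would give \<open>side (i - 1) p > side l p\<close> and
  \<open>side (l - 1) p > side i p\<close>. Written as products of sines, these two differences share the factor
  \<open>S\<close>, and their product is minus a square times a nonnegative number.\<close>

lemma exit_side_unique:
  assumes i: "side (i - 1) p > 0" "side i p \<le> 0" and l: "side (l - 1) p > 0" "side l p \<le> 0"
  shows "\<exists>z. l = i + int N * z"
proof -
  define D where "D = (l - i) mod int N"
  have D: "0 \<le> D" "D < int N" using N by (auto simp: D_def)
  have lD: "l = (i + D) + int N * ((l - i) div int N)"
    unfolding D_def by (simp add: algebra_simps)
  then have "side l = side (i + D)" by (metis side_periodic)
  moreover have "l - 1 = (i + D - 1) + int N * ((l - i) div int N)" using lD by simp
  then have "side (l - 1) = side (i + D - 1)" by (metis side_periodic)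
  ultimately have D': "side (i + D - 1) p > 0" "side (i + D) p \<le> 0" using l by auto
  have "D = 0"
  proof (rule ccontr)
    assume "D \<noteq> 0"
    obtain \<rho> \<psi> where pol: "\<And>i. side i p = \<rho> * cos (\<psi> + 2 * \<alpha> * of_int i) - R * cos \<alpha>"
      using side_polar by blast
    have diff: "side a p - side b p = 2 * \<rho> * sin (\<psi> + \<alpha> * of_int (a + b)) * sin (\<alpha> * of_int (b - a))" for a b
    proof -
      have "side a p - side b p = \<rho> * (cos (\<psi> + 2 * \<alpha> * of_int a) - cos (\<psi> + 2 * \<alpha> * of_int b))"
        unfolding pol by (simp add: algebra_simps)
      moreover have e: "(\<psi> + 2 * \<alpha> * of_int a + (\<psi> + 2 * \<alpha> * of_int b)) / 2 = \<psi> + \<alpha> * of_int (a + b)"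
        "(\<psi> + 2 * \<alpha> * of_int b - (\<psi> + 2 * \<alpha> * of_int a)) / 2 = \<alpha> * of_int (b - a)"
        by (simp_all add: field_simps)
      ultimately show ?thesis unfolding cos_diff_cos e by simp
    qed
    define S where "S = sin (\<psi> + \<alpha> * of_int (2 * i + D - 1))"
    have 1: "side (i - 1) p - side (i + D) p = 2 * \<rho> * S * sin (\<alpha> * (of_int D + 1))"
      using diff[of "i - 1" "i + D"] by (simp add: S_def algebra_simps)
    have "sin (\<alpha> * (1 - of_int D)) = - sin (\<alpha> * (of_int D - 1))"
      by (metis minus_diff_eq mult_minus_right sin_minus)
    then have 2: "side (i + D - 1) p - side i p = - 2 * \<rho> * S * sin (\<alpha> * (of_int D - 1))"
      using diff[of "i + D - 1" i] by (simp add: S_def algebra_simps)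
    have "0 < (side (i - 1) p - side (i + D) p) * (side (i + D - 1) p - side i p)"
      using i D' by (intro mult_pos_pos) auto
    also have "\<dots> = - (2 * \<rho> * S)\<^sup>2 * (sin (\<alpha> * (of_int D + 1)) * sin (\<alpha> * (of_int D - 1)))"
      unfolding 1 2 by (simp add: power2_eq_square)
    also have "\<dots> \<le> 0"
    proof -
      have "0 \<le> sin (\<alpha> * (of_int D + 1)) * sin (\<alpha> * (of_int D - 1))"
        using D \<open>D \<noteq> 0\<close> by (intro sin_alpha_prod_nonneg) auto
      then have "0 \<le> (2 * \<rho> * S)\<^sup>2 * (sin (\<alpha> * (of_int D + 1)) * sin (\<alpha> * (of_int D - 1)))"
        by (rule mult_nonneg_nonneg[OF zero_le_power2])
      then show ?thesis by simp
    qed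
    finally show False by simp
  qed
  then show ?thesis using lD by auto
qed

text \<open>The normals add up to zero, so the signed distances cannot all be positive.\<close>

lemma ex_hidden_side: "\<exists>i. side i p \<le> 0"
proof (rule ccontr)
  assume *: "\<not> (\<exists>i. side i p \<le> 0)"
  have "normal (int n) = cis (- 2 * \<alpha> * real n) * normal 0" for n
    using normal_add[of 0 "int n"] by simp
  then have "(\<Sum>n<N. normal (int n)) = 0"
    using vertices_sum_zero by (simp flip: sum_distrib_right)
  then have "(\<Sum>n<N. inner (normal (int n)) p) = 0"
    by (simp flip: inner_sum_left)
  moreover have "inner (normal (int n)) p > 0" for n
  proof -
    have "side (int n) p > 0" using * by (simp add: not_le)
    moreover have "R * cos \<alpha> > 0" using R cos_alpha_pos by simp
    ultimately show ?thesis unfolding side_def by linarith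
  qed
  then have "(\<Sum>n<N. inner (normal (int n)) p) > 0" using N by (intro sum_pos) (auto simp: lessThan_empty_iff)
  ultimately show False by simp
qed

lemma ex_exit_side:
  assumes "p \<notin> polygon c" shows "\<exists>i. side (i - 1) p > 0 \<and> side i p \<le> 0"
proof (rule ccontr)
  assume *: "\<not> ?thesis"
  obtain a where a: "side a p > 0" using assms by (auto simp: polygon_eq not_le)
  obtain b where b: "side b p \<le> 0" using ex_hidden_side by blast
  have pos: "side i p > 0" if "a \<le> i" for i
    using that
  proof (induction i rule: int_ge_induct)
    case (step i) then show ?case using * by (metis add_diff_cancel_right' not_le)
  qed (rule a)
  have "\<bar>a\<bar> + \<bar>b\<bar> \<le> int N * (\<bar>a\<bar> + \<bar>b\<bar>)"
    using mult_right_mono[of 1 "int N" "\<bar>a\<bar> + \<bar>b\<bar>"] N by simp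
  then have "a \<le> b + int N * (\<bar>a\<bar> + \<bar>b\<bar>)" by linarith
  from pos[OF this] b show False by (simp add: side_periodic)
qed

lemma on_side_line:
  assumes "side i p = 0" shows "\<exists>t. p = c i + t *\<^sub>R (c i - c (i + 1))"
proof -
  define z where "z = (p - c i) / normal i"
  have "normal i \<noteq> 0" using norm_normal[of i] by force
  then have p: "p = c i + normal i * z" by (simp add: z_def)
  have "inner (normal i * 1) (normal i * z) = inner 1 z"
    by (rule inner_mult_unit) (rule norm_normal)
  moreover have "side i p = side i (c i) + inner (normal i) (normal i * z)"
    by (simp add: p side_def inner_add_right)
  ultimately have Re: "Re z = 0" using assms by (simp add: inner_complex_def)
  have "c i - c (i + 1) = normal i * (R * (cis \<alpha> - cis (- \<alpha>)))"
    by (simp add: c_eq normal_def cis_mult algebra_simps)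
  also have "cis \<alpha> - cis (- \<alpha>) = 2 * \<i> * sin \<alpha>" by (simp add: complex_eq_iff)
  finally have "c i - c (i + 1) = normal i * (R * (2 * \<i> * sin \<alpha>))" .
  moreover have "z = (Im z / (2 * R * sin \<alpha>)) *\<^sub>R (R * (2 * \<i> * sin \<alpha>))"
    using Re R sin_alpha_nz by (simp add: complex_eq_iff)
  ultimately have "p = c i + (Im z / (2 * R * sin \<alpha>)) *\<^sub>R (c i - c (i + 1))"
    using p by (metis mult_scaleR_right)
  then show ?thesis by blast
qed

text \<open>On its line, the edge \<open>i\<close> is left behind \<open>c i\<close> exactly where the edge \<open>i - 1\<close> becomes visible.\<close>

lemma trailing_ext_eq: "trailing_ext c i = {p. side i p = 0 \<and> side (i - 1) p > 0}"
proof -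
  have s: "side i (c i + t *\<^sub>R (c i - c (i + 1))) = 0"
    "side (i - 1) (c i + t *\<^sub>R (c i - c (i + 1))) > 0 \<longleftrightarrow> t > 0" for t
    using side_vertex_neg(1)[of i] by (simp_all add: side_affine zero_less_mult_iff mult_less_0_iff)
  show ?thesis
  proof (intro set_eqI iffI)
    fix p assume "p \<in> {p. side i p = 0 \<and> side (i - 1) p > 0}"
    moreover from this obtain t where "p = c i + t *\<^sub>R (c i - c (i + 1))" using on_side_line by blast
    ultimately show "p \<in> trailing_ext c i" using s by (auto simp: trailing_ext_def)
  qed (auto simp: trailing_ext_def s)
qed

text \<open>Sectors, step regions and the components of the domain of the inverse are all of this form, so
  that openness, convexity and closures are settled once.\<close>

definition cell :: "int set \<Rightarrow> int set \<Rightarrow> complex set" where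
  "cell A B = {p. (\<forall>i\<in>A. side i p > 0) \<and> (\<forall>i\<in>B. side i p < 0)}"

lemma closure_cell:
  assumes "cell A B \<noteq> {}"
  shows "closure (cell A B) = {p. (\<forall>i\<in>A. side i p \<ge> 0) \<and> (\<forall>i\<in>B. side i p \<le> 0)}"
proof -
  define v where "v = case_sum (\<lambda>i. - normal i) normal"
  define b :: "int + int \<Rightarrow> real" where "b = case_sum (\<lambda>i. - R * cos \<alpha>) (\<lambda>i. R * cos \<alpha>)"
  obtain s where s: "s \<in> cell A B" using assms by blast
  have "cell A B = {x. \<forall>i\<in>A <+> B. inner (v i) x < b i}"
    by (simp add: cell_def v_def b_def side_def Plus_def ball_Un)
  moreover have "{x. \<forall>i\<in>A <+> B. inner (v i) x \<le> b i} =
      {p. (\<forall>i\<in>A. side i p \<ge> 0) \<and> (\<forall>i\<in>B. side i p \<le> 0)}"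
    by (simp add: v_def b_def side_def Plus_def ball_Un)
  ultimately show ?thesis using s closure_open_halfspaces[of "A <+> B" v s b] by auto
qed

lemma open_cell: assumes "finite A" "finite B" shows "open (cell A B)"
proof -
  have "cell A B = (\<Inter>i\<in>A. {p. R * cos \<alpha> < inner (normal i) p}) \<inter> (\<Inter>i\<in>B. {p. inner (normal i) p < R * cos \<alpha>})"
    by (auto simp: cell_def side_def)
  then show ?thesis using assms
    by (auto intro!: open_INT open_Int open_halfspace_lt open_halfspace_gt)
qed

lemma convex_cell: "convex (cell A B)"
proof -
  have "cell A B = (\<Inter>i\<in>A. {p. inner (normal i) p > R * cos \<alpha>}) \<inter> (\<Inter>i\<in>B. {p. inner (normal i) p < R * cos \<alpha>})"
    by (auto simp: cell_def side_def)
  then show ?thesis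
    by (auto intro!: convex_INT convex_Int convex_halfspace_lt convex_halfspace_gt)
qed

lemma sector_eq_cell: "sector i = cell {i - 1} {i}"
  by (auto simp: sector_def cell_def)

lemma sector_nonempty: "sector i \<noteq> {}"
proof -
  have "c i + 1 *\<^sub>R (c (i - 1) - c (i + 1)) \<in> sector i"
    unfolding sector_def mem_Collect_eq side_affine
    using side_vertex_neg[of i] side_vertex_same(1)[of "i - 1"] by simp
  then show ?thesis by blast
qed

lemma open_sector: "open (sector i)" and convex_sector: "convex (sector i)"
  by (simp_all add: sector_eq_cell open_cell convex_cell)

lemma closure_sector: "closure (sector i) = {p. side (i - 1) p \<ge> 0 \<and> side i p \<le> 0}"
  using closure_cell[of "{i - 1}" "{i}"] sector_nonempty by (simp add: sector_eq_cell)

lemma frontier_sector: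
  "frontier (sector i) = trailing_ext c (i - 1) \<union> closed_segment (c (i - 1)) (c i) \<union> trailing_ext c i"
proof -
  have ray: "{p. side (i - 1) p = 0 \<and> side i p \<le> 0} = trailing_ext c (i - 1) \<union> closed_segment (c (i - 1)) (c i)"
  proof -
    have s: "side (i - 1) (c (i - 1) + t *\<^sub>R (c (i - 1) - c i)) = 0"
      "side i (c (i - 1) + t *\<^sub>R (c (i - 1) - c i)) \<le> 0 \<longleftrightarrow> -1 \<le> t" for t
    proof -
      show "side (i - 1) (c (i - 1) + t *\<^sub>R (c (i - 1) - c i)) = 0"
        using side_vertex_same(1)[of "i - 1"] by (simp add: side_affine)
      have "side i (c (i - 1) + t *\<^sub>R (c (i - 1) - c i)) = (1 + t) * side i (c (i - 1))"
        unfolding side_affine by (simp add: algebra_simps)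
      then show "side i (c (i - 1) + t *\<^sub>R (c (i - 1) - c i)) \<le> 0 \<longleftrightarrow> -1 \<le> t"
        using side_vertex_neg(2)[of i] by (simp add: mult_le_0_iff) linarith
    qed
    have "p \<in> trailing_ext c (i - 1) \<union> closed_segment (c (i - 1)) (c i) \<longleftrightarrow>
      (\<exists>t\<ge>-1. p = c (i - 1) + t *\<^sub>R (c (i - 1) - c i))" (is "?L p \<longleftrightarrow> ?R p") for p
    proof
      assume "?L p"
      then show "?R p"
      proof
        assume "p \<in> closed_segment (c (i - 1)) (c i)"
        then obtain u where "0 \<le> u" "u \<le> 1" "p = (1 - u) *\<^sub>R c (i - 1) + u *\<^sub>R c i"
          by (auto simp: in_segment)
        then have "- u \<ge> - 1" "p = c (i - 1) + (- u) *\<^sub>R (c (i - 1) - c i)"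
          by (auto simp: algebra_simps)
        then show ?thesis by blast
      next
        assume "p \<in> trailing_ext c (i - 1)"
        then obtain t where "t > 0" "p = c (i - 1) + t *\<^sub>R (c (i - 1) - c i)"
          by (auto simp: trailing_ext_def)
        moreover from this have "- 1 \<le> t" by simp
        ultimately show ?thesis by blast
      qed
    next
      assume "?R p"
      then obtain t where t: "- 1 \<le> t" "p = c (i - 1) + t *\<^sub>R (c (i - 1) - c i)" by blast
      show "?L p"
      proof (cases "t > 0")
        case True then show ?thesis using t by (auto simp: trailing_ext_def)
      next
        case False
        then have "0 \<le> - t" "- t \<le> 1" "p = (1 - (- t)) *\<^sub>R c (i - 1) + (- t) *\<^sub>R c i"
          using t by (auto simp: algebra_simps)
        then show ?thesis unfolding in_segment Un_iff by blast
      qed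
    qed
    moreover have "side (i - 1) p = 0 \<and> side i p \<le> 0 \<longleftrightarrow>
      (\<exists>t\<ge>-1. p = c (i - 1) + t *\<^sub>R (c (i - 1) - c i))" (is "?L p \<longleftrightarrow> ?R p") for p
    proof
      assume "?L p"
      then obtain t where "p = c (i - 1) + t *\<^sub>R (c (i - 1) - c i)"
        using on_side_line[of "i - 1" p] by auto
      then show "?R p" using s(2) \<open>?L p\<close> by blast
    qed (use s in blast)
    ultimately show ?thesis by (intro set_eqI) (simp only: mem_Collect_eq)
  qed
  have "frontier (sector i) = closure (sector i) - sector i"
    by (simp add: frontier_def interior_open open_sector)
  also have "\<dots> = {p. side (i - 1) p = 0 \<and> side i p \<le> 0} \<union> {p. side i p = 0 \<and> side (i - 1) p > 0}"
    unfolding closure_sector by (auto simp: sector_def)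
  finally show ?thesis unfolding ray trailing_ext_eq[of i] .
qed

lemma sector_disjoint: assumes "p \<in> sector i" "p \<in> sector l" shows "\<exists>z. l = i + int N * z"
  using assms exit_side_unique by (auto simp: sector_def less_imp_le)

lemma sector_disjoint_or_eq: "sector i = sector l \<or> sector i \<inter> sector l = {}"
proof (rule disjCI)
  assume "sector i \<inter> sector l \<noteq> {}"
  then obtain p where "p \<in> sector i" "p \<in> sector l" by auto
  then obtain z where "l = i + int N * z" using sector_disjoint by blast
  then show "sector i = sector l" by (simp add: sector_periodic)
qed

lemma tau_domain_eq: "tau_domain c = \<Union>(range sector)"
proof (intro set_eqI iffI)
  fix p assume p: "p \<in> tau_domain c"
  then obtain i where i: "side (i - 1) p > 0" "side i p \<le> 0"
    using ex_exit_side by (auto simp: tau_domain_def)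
  moreover have "p \<notin> trailing_ext c i" using p by (auto simp: tau_domain_def)
  ultimately have "p \<in> sector i" by (auto simp: trailing_ext_eq sector_def)
  then show "p \<in> \<Union>(range sector)" by blast
next
  fix p assume "p \<in> \<Union>(range sector)"
  then obtain i where i: "side (i - 1) p > 0" "side i p < 0" by (auto simp: sector_def)
  have "p \<notin> trailing_ext c l" for l
  proof
    assume "p \<in> trailing_ext c l"
    then have l: "side (l - 1) p > 0" "side l p = 0" by (auto simp: trailing_ext_eq)
    then obtain z where "l = i + int N * z" using exit_side_unique[of i p l] i by auto
    then show False using i l by (simp add: side_periodic)
  qed
  moreover have "p \<notin> polygon c" using i by (auto simp: polygon_eq not_le)
  ultimately show "p \<in> tau_domain c" by (auto simp: tau_domain_def)
qed

lemma components_tau_domain: "components (tau_domain c) = range sector"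
proof -
  have "components (tau_domain c) = range sector - {{}}"
  proof (rule components_of_disjoint_open_cover[OF tau_domain_eq])
    fix S T assume "S \<in> range sector" "T \<in> range sector" "S \<noteq> T"
    then show "S \<inter> T = {}" using sector_disjoint_or_eq by blast
  qed (auto simp: open_sector convex_sector convex_connected)
  then show ?thesis using sector_nonempty by auto
qed

text \<open>The midpoint of the edge from \<open>c (i - 1)\<close> to \<open>c i\<close> lies on the frontier. A line supporting the
  polygon that has this midpoint on or beyond it must contain the whole edge.\<close>

lemma frontier_sector_inject:
  assumes "frontier (sector l) = frontier (sector i)" shows "sector l = sector i"
proof -
  define D where "D = i - l"
  define M where "M = (1/2) *\<^sub>R c (i - 1) + (1/2) *\<^sub>R c i"
  have "M \<in> closed_segment (c (i - 1)) (c i)"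
    unfolding M_def in_segment by (intro exI[of _ "1/2"]) auto
  then have "M \<in> closure (sector l)"
    using assms frontier_sector[of i] by (auto simp: frontier_def)
  then have "0 \<le> side (l - 1) M" by (simp add: closure_sector)
  moreover have "side (l - 1) M = (side (l - 1) (c (i - 1)) + side (l - 1) (c i)) / 2"
    by (simp add: M_def side_def inner_add_right algebra_simps)
  ultimately have le: "0 \<le> side (l - 1) (c (i - 1)) + side (l - 1) (c i)" by simp
  have "side (l - 1) (c (i - 1)) = 0" "side (l - 1) (c i) = 0"
    using le side_vertex_le[of "l - 1" "i - 1"] side_vertex_le[of "l - 1" i] by simp_all
  moreover have "i - 1 = (l - 1) + D" "i = (l - 1) + (D + 1)" by (auto simp: D_def)
  ultimately have "side (l - 1) (c ((l - 1) + D)) = 0" "side (l - 1) (c ((l - 1) + (D + 1))) = 0"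
    by metis+
  then have "sin (\<alpha> * of_int D) * sin (\<alpha> * (of_int D - 1)) = 0"
    "sin (\<alpha> * (of_int D + 1)) * sin (\<alpha> * of_int D) = 0"
    unfolding side_vertex using R by auto
  then have *: "sin (\<alpha> * of_int D) = 0 \<or> (sin (\<alpha> * (of_int D - 1)) = 0 \<and> sin (\<alpha> * (of_int D + 1)) = 0)"
    by auto
  have "sin (\<alpha> * of_int D) = 0"
  proof (rule ccontr)
    assume nz: "sin (\<alpha> * of_int D) \<noteq> 0"
    have "sin (\<alpha> * (of_int D - 1)) = sin (\<alpha> * of_int D) * cos \<alpha> - cos (\<alpha> * of_int D) * sin \<alpha>"
      "sin (\<alpha> * (of_int D + 1)) = sin (\<alpha> * of_int D) * cos \<alpha> + cos (\<alpha> * of_int D) * sin \<alpha>"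
      by (simp_all add: right_diff_distrib distrib_left sin_diff sin_add)
    then show False using * nz cos_alpha_pos by auto
  qed
  then have "sin (\<bar>\<alpha>\<bar> * of_int D) = 0" by (cases "\<alpha> \<ge> 0") auto
  then obtain z :: int where "\<bar>\<alpha>\<bar> * of_int D = of_int z * pi"
    unfolding sin_zero_iff_int2 by blast
  then have "of_int D = real N * of_int z" using N by (simp add: alpha field_simps)
  then have "D = int N * z" by (metis of_int_eq_iff of_int_mult of_int_of_nat_eq)
  then have "i = l + int N * z" by (simp add: D_def)
  then show ?thesis by (simp add: sector_periodic)
qed

text \<open>The sectors are exactly the components of the domain, and each is determined by its frontier.\<close>

lemma has_support_iff: "has_support c p i \<longleftrightarrow> p \<in> sector i"
  unfolding has_support_def components_tau_domain
  unfolding frontier_sector[symmetric]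
  using frontier_sector_inject by auto

lemma tau_sector: assumes "p \<in> sector i" shows "tau c p = 2 * c i - p"
proof -
  have "support_vertex c p = c i"
    unfolding support_vertex_def has_support_iff
  proof (rule the_equality)
    show "\<exists>l. p \<in> sector l \<and> c i = c l" using assms by blast
  next
    fix v assume "\<exists>l. p \<in> sector l \<and> v = c l"
    then show "v = c i" using sector_disjoint[OF assms] c_periodic by blast
  qed
  then show ?thesis by (simp add: tau_def)
qed

section \<open>Supports of the inverse map\<close>

interpretation rev: regular_vertices N R \<theta> "- \<alpha>" "\<lambda>i. c (- i)"
  using N R alpha by unfold_locales (simp_all add: c_eq)

lemma rev_side: "rev.side i = side (- i - 1)"
  by (rule ext) (simp add: rev.side_def side_def rev.normal_def normal_def algebra_simps)

lemma rev_trailing_ext: "trailing_ext (\<lambda>i. c (- i)) i = forward_ext c (- i - 1)"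
  by (simp add: trailing_ext_def forward_ext_def)

lemma rev_tau_domain: "tau_domain (\<lambda>i. c (- i)) = tau_inv_domain c"
proof -
  have reindex: "range (\<lambda>i. g (f i)) = range g" if "surj f" for f :: "int \<Rightarrow> int" and g :: "int \<Rightarrow> 'b"
    using that image_image[of g f UNIV] by simp
  have "range (\<lambda>i. c (- i)) = range c"
    by (rule reindex) (rule surjI[of _ uminus], simp)
  moreover have "range (\<lambda>i. forward_ext c (- i - 1)) = range (forward_ext c)"
    by (rule reindex) (rule surjI[of _ "\<lambda>i. - i - 1"], simp)
  ultimately show ?thesis
    unfolding tau_domain_def tau_inv_domain_def polygon_def rev_trailing_ext by simp
qed

lemma has_inv_support_iff: "has_inv_support c p i \<longleftrightarrow> side i p > 0 \<and> side (i - 1) p < 0"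
proof -
  have "has_inv_support c p i \<longleftrightarrow> has_support (\<lambda>i. c (- i)) p (- i)"
    unfolding has_inv_support_def has_support_def rev_tau_domain rev_trailing_ext
    by (simp add: Un_ac closed_segment_commute add.commute)
  also have "\<dots> \<longleftrightarrow> side i p > 0 \<and> side (i - 1) p < 0"
    unfolding rev.has_support_iff rev.sector_def rev_side by simp
  finally show ?thesis .
qed

end

section \<open>Polygons with a rotational symmetry\<close>

text \<open>Half-planes at equal distance \<open>r\<close> from \<open>q\<close>, whose normals are permuted by a rotation \<open>\<zeta>\<close> that is
  neither the identity nor a half turn. The sum of a normal over the powers of \<open>\<zeta>\<close> vanishes, so an
  upper bound on all inner products is also a lower bound, and two independent normals bound the
  region. The vertices are permuted by the rotation about \<open>q\<close>, so their mean is its only fixed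
  point \<open>q\<close>.\<close>

lemma rotation_invariant_polygon:
  fixes V :: "complex set" and \<zeta> q :: complex and r :: real and M :: nat
  assumes V: "finite V" "V \<noteq> {}" "\<And>v. v \<in> V \<Longrightarrow> norm v = 1" and inv: "\<And>v. v \<in> V \<Longrightarrow> \<zeta> * v \<in> V"
    and M: "M > 0" "\<zeta> ^ M = 1" and \<zeta>: "norm \<zeta> = 1" "Im \<zeta> \<noteq> 0" and r: "r > 0"
  defines "S \<equiv> {p. \<forall>v\<in>V. inner v (p - q) < r}"
  shows "(\<lambda>p. q + \<zeta> * (p - q)) ` S = S" "open_convex_polygon S" "center S = q"
proof -
  define f where "f p = q + \<zeta> * (p - q)" for p
  define g where "g p = q + cnj \<zeta> * (p - q)" for p
  define Q where "Q = {p. \<forall>v\<in>V. inner v (p - q) \<le> r}"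
  have \<zeta>1: "cnj \<zeta> * \<zeta> = 1" "\<zeta> * cnj \<zeta> = 1"
    using \<zeta>(1) by (simp_all add: complex_norm_square[symmetric] mult.commute)
  have fg: "f (g p) = p" "g (f p) = p" for p
    using \<zeta>1 by (simp_all add: f_def g_def mult.assoc[symmetric])
  have pow: "\<zeta> ^ n * v \<in> V" if "v \<in> V" for n v
    using that by (induction n) (auto simp: mult.assoc inv)
  have "cnj \<zeta> = cnj \<zeta> * \<zeta> ^ M" using M by simp
  also have "\<dots> = cnj \<zeta> * \<zeta> * \<zeta> ^ (M - 1)" using M(1) by (cases M) auto
  finally have "cnj \<zeta> = \<zeta> ^ (M - 1)" using \<zeta>1 by simp
  then have inv': "cnj \<zeta> * v \<in> V" if "v \<in> V" for v using pow[OF that] by metis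
  have "inner v (f p - q) = inner (cnj \<zeta> * v) (p - q)" "inner v (g p - q) = inner (\<zeta> * v) (p - q)" for v p
    by (simp_all add: f_def g_def inner_complex_def algebra_simps)
  note fg_inner = this
  have fS: "f p \<in> S" "g p \<in> S" if "p \<in> S" for p
    using that inv inv' by (auto simp: S_def fg_inner)
  have fQ: "f p \<in> Q" "g p \<in> Q" if "p \<in> Q" for p
    using that inv inv' by (auto simp: Q_def fg_inner)
  have image: "f ` X = X" if "\<And>p. p \<in> X \<Longrightarrow> f p \<in> X" "\<And>p. p \<in> X \<Longrightarrow> g p \<in> X" for X
    using that fg by (metis image_eqI image_subset_iff subsetI subset_antisym)
  show "(\<lambda>p. q + \<zeta> * (p - q)) ` S = S" using image fS unfolding f_def by blast
  have "q \<in> S" using r by (simp add: S_def)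
  have S_eq: "S = {x. \<forall>v\<in>V. inner v x < r + inner v q}" and Q_eq: "Q = {x. \<forall>v\<in>V. inner v x \<le> r + inner v q}"
    by (auto simp: S_def Q_def inner_diff_right algebra_simps)
  have closure: "closure S = Q"
    unfolding S_eq Q_eq using r by (intro closure_open_halfspaces[of _ _ q]) simp
  have "S = (\<Inter>v\<in>V. {x. inner v x < r + inner v q})" by (auto simp: S_eq)
  then have "open S" "convex S"
    using V by (auto intro!: open_INT open_halfspace_lt convex_INT convex_halfspace_lt)
  have "bounded Q"
  proof -
    have bound: "\<bar>inner w (p - q)\<bar> \<le> real M * r" if "w \<in> V" "p \<in> Q" for w p
    proof -
      have "(\<Sum>n<M. inner (\<zeta> ^ n * w) (p - q)) = inner ((\<Sum>n<M. \<zeta> ^ n) * w) (p - q)"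
        by (simp add: inner_sum_left sum_distrib_right)
      also have "(\<Sum>n<M. \<zeta> ^ n) = 0"
        using M \<zeta> by (intro sum_powers_root_of_unity) auto
      finally have zero: "(\<Sum>n<M. inner (\<zeta> ^ n * w) (p - q)) = 0" by simp
      have le: "inner (\<zeta> ^ n * w) (p - q) \<le> r" for n
        using pow[OF that(1)] that(2) by (auto simp: Q_def)
      have "(\<Sum>n<M. inner (\<zeta> ^ n * w) (p - q)) =
          inner w (p - q) + (\<Sum>n\<in>{..<M} - {0}. inner (\<zeta> ^ n * w) (p - q))"
        using M by (subst sum.remove[of _ 0]) auto
      also have "(\<Sum>n\<in>{..<M} - {0}. inner (\<zeta> ^ n * w) (p - q)) \<le> real (card ({..<M} - {0})) * r"
        by (intro sum_bounded_above) (use le in auto)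
      also have "real (card ({..<M} - {0})) * r = real M * r - r"
        using M by (simp add: of_nat_diff algebra_simps)
      finally have "- (real M * r - r) \<le> inner w (p - q)" using zero by simp
      moreover have "inner w (p - q) \<le> r" using le[of 0] by simp
      moreover have "r \<le> real M * r" using M r mult_right_mono[of 1 "real M" r] by simp
      ultimately show ?thesis using r by linarith
    qed
    obtain v where v: "v \<in> V" using V by auto
    define B where "B = real M * r"
    have "norm p \<le> norm q + (B + 2 * B / \<bar>Im \<zeta>\<bar>)" if p: "p \<in> Q" for p
    proof -
      define z where "z = (p - q) / v"
      have "v \<noteq> 0" using V(3)[OF v] by auto
      then have z: "p - q = v * z" by (simp add: z_def)
      have "inner v (p - q) = inner 1 z"
        unfolding z using inner_mult_unit[of v 1 z] V(3)[OF v] by simp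
      moreover have "inner (\<zeta> * v) (p - q) = inner \<zeta> z"
        unfolding z mult.commute[of \<zeta>] using V(3)[OF v] by (rule inner_mult_unit)
      ultimately have *: "\<bar>Re z\<bar> \<le> B" "\<bar>inner \<zeta> z\<bar> \<le> B"
        using bound[OF v p] bound[OF inv[OF v] p] by (simp_all add: B_def inner_complex_def)
      have "\<bar>Re \<zeta> * Re z\<bar> \<le> 1 * B"
        unfolding abs_mult using abs_Re_le_cmod[of \<zeta>] \<zeta> * by (intro mult_mono) auto
      then have "\<bar>Im \<zeta> * Im z\<bar> \<le> 2 * B" using * by (simp add: inner_complex_def)
      then have "\<bar>Im z\<bar> \<le> 2 * B / \<bar>Im \<zeta>\<bar>"
        using \<zeta> by (simp add: abs_mult pos_le_divide_eq mult.commute)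
      then have "norm z \<le> B + 2 * B / \<bar>Im \<zeta>\<bar>" using * cmod_le[of z] by simp
      moreover have "norm (p - q) = norm z" unfolding z by (simp add: norm_mult V(3)[OF v])
      ultimately show ?thesis using norm_triangle_sub[of p q] by simp
    qed
    then show ?thesis unfolding bounded_iff by blast
  qed
  moreover have polyQ: "polyhedron Q"
  proof -
    have "Q = \<Inter> ((\<lambda>v. {x. inner v x \<le> r + inner v q}) ` V)" by (auto simp: Q_eq)
    then show ?thesis using V by (auto intro!: polyhedron_Inter polyhedron_halfspace_le)
  qed
  ultimately have "polytope Q" by (simp add: polytope_eq_bounded_polyhedron)
  moreover have "S = interior Q"
    using convex_interior_closure[OF \<open>convex S\<close>] closure \<open>open S\<close> by (simp add: interior_open)
  ultimately show "open_convex_polygon S" using \<open>q \<in> S\<close> by (auto simp: open_convex_polygon_def)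
  define E where "E = {x. x extreme_point_of Q}"
  have "finite E" using finite_polyhedron_extreme_points[OF polyQ] by (simp add: E_def)
  have "compact Q" "convex Q"
    using \<open>polytope Q\<close> by (auto simp: polytope_imp_compact polytope_imp_convex)
  moreover have "Q \<noteq> {}" using \<open>q \<in> S\<close> closure closure_subset by blast
  ultimately have "E \<noteq> {}" using Krein_Milman_Minkowski[of Q] by (auto simp: E_def)
  have "f ` E = E"
  proof -
    have "linear ((*) \<zeta>)" "inj ((*) \<zeta>)"
      using \<zeta> by (auto simp: linear_times intro!: injI)
    then have *: "\<zeta> * x extreme_point_of (*) \<zeta> ` Q \<longleftrightarrow> x extreme_point_of Q" for x
      using face_of_linear_image[of "(*) \<zeta>" "{x}" Q] by (simp add: face_of_singleton)
    have f: "f x = (q - \<zeta> * q) + \<zeta> * x" for x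
      by (simp add: f_def algebra_simps)
    have "f ` Q = (\<lambda>x. (q - \<zeta> * q) + x) ` ((*) \<zeta> ` Q)"
      unfolding image_image f ..
    then have "f x extreme_point_of f ` Q \<longleftrightarrow> x extreme_point_of Q" for x
      using extreme_point_of_translation_eq[of "q - \<zeta> * q" "\<zeta> * x" "(*) \<zeta> ` Q"] * f by simp
    then have "f x \<in> E \<longleftrightarrow> x \<in> E" for x using image[of Q] fQ by (simp add: E_def)
    then show ?thesis using image[of E] fg by metis
  qed
  moreover have "inj_on f E" using fg by (metis inj_onI)
  ultimately have "(\<Sum>x\<in>E. x) = (\<Sum>x\<in>E. f x)" by (metis (no_types, lifting) sum.reindex_cong)
  also have "\<dots> = of_nat (card E) * (q - \<zeta> * q) + \<zeta> * (\<Sum>x\<in>E. x)"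
    by (simp add: f_def sum.distrib sum_subtractf sum_distrib_left algebra_simps)
  finally have "(1 - \<zeta>) * ((\<Sum>x\<in>E. x) - of_nat (card E) * q) = 0" by (simp add: algebra_simps)
  moreover have "1 - \<zeta> \<noteq> 0" using \<zeta>(2) by auto
  ultimately have "(\<Sum>x\<in>E. x) = of_nat (card E) * q" by simp
  moreover have "card E \<noteq> 0" using \<open>finite E\<close> \<open>E \<noteq> {}\<close> by simp
  moreover have "polygon_vertices S = E" by (simp add: polygon_vertices_def closure E_def)
  ultimately show "center S = q" by (simp add: center_def)
qed

section \<open>Orbits of constant step\<close>

context regular_vertices begin

lemma side_rotate: "side (i + l) (cis (- 2 * \<alpha> * of_int l) * z) = side i z"
  unfolding side_def normal_add by (subst inner_mult_unit) auto

lemma sector_rotate: "cis (- 2 * \<alpha> * of_int l) * z \<in> sector (i + l) \<longleftrightarrow> z \<in> sector i"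
proof -
  have "i + l - 1 = (i - 1) + l" by simp
  then show ?thesis unfolding sector_def mem_Collect_eq by (metis side_rotate)
qed

lemma side_reflect: "side i (2 * x - p) = 2 * side i x - side i p"
  by (simp add: side_def inner_diff_right inner_complex_def algebra_simps)

text \<open>The point \<open>q\<close> is the one whose reflection in \<open>c (j + k)\<close> is its rotation \<open>w * q\<close> by \<open>k\<close> vertices.
  By rotational symmetry it keeps advancing by \<open>k\<close> vertices, and every other orbit with the same
  support vertices differs from the orbit of \<open>q\<close> by an offset that just changes sign.\<close>

context
  fixes j :: int and k :: nat and q :: complex and w \<zeta> :: complex
  assumes w_def: "w = cis (- 2 * \<alpha> * real k)" and \<zeta>_def: "\<zeta> = - w"
    and q: "(1 + w) * q = 2 * c (j + int k)"
begin

lemma w_power: "w ^ n = cis (- 2 * \<alpha> * of_int (int n * int k))"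
  by (simp add: w_def Complex.DeMoivre mult_ac)

lemma w_cnj: "cnj w * w = 1"
  by (simp add: w_def cis_cnj cis_mult)

lemma w_root: "w ^ N = 1"
  unfolding w_power by (rule cis_period)

lemma \<zeta>_root: "\<zeta> ^ (2 * N) = 1"
proof -
  have "\<zeta> ^ (2 * N) = (w\<^sup>2) ^ N" by (simp add: \<zeta>_def power_mult)
  also have "\<dots> = (w ^ N)\<^sup>2" by (metis power_mult mult.commute)
  finally show ?thesis using w_root by simp
qed

text \<open>Turning the \<open>n\<close>-th point of the orbit back by \<open>w ^ n\<close> compares all of them with one sector; the
  offset is then turned by powers of \<open>- cnj w\<close>.\<close>

lemma orbit_rotate:
  "w ^ n * q + (- 1) ^ n * d \<in> sector (j + (int n + 1) * int k) \<longleftrightarrow> q + cnj \<zeta> ^ n * d \<in> sector (j + int k)"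
proof -
  have "w ^ n * cnj \<zeta> ^ n = (- 1) ^ n"
    using w_cnj by (simp add: \<zeta>_def flip: power_mult_distrib) (simp add: mult.commute)
  then have "w ^ n * q + (- 1) ^ n * d = w ^ n * (q + cnj \<zeta> ^ n * d)"
    by (simp add: distrib_left mult.assoc[symmetric])
  moreover have "j + (int n + 1) * int k = (j + int k) + int n * int k" by (simp add: algebra_simps)
  ultimately show ?thesis unfolding w_power by (simp only: sector_rotate)
qed

lemma tau_step:
  assumes "w ^ n * q + (- 1) ^ n * d \<in> sector (j + (int n + 1) * int k)"
  shows "tau c (w ^ n * q + (- 1) ^ n * d) = w ^ Suc n * q + (- 1) ^ Suc n * d"
proof -
  have "j + (int n + 1) * int k = (j + int k) + int n * int k" by (simp add: algebra_simps)
  then have "c (j + (int n + 1) * int k) = w ^ n * c (j + int k)"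
    unfolding w_power by (simp only: c_add)
  then have "2 * c (j + (int n + 1) * int k) = w ^ n * ((1 + w) * q)" using q by simp
  then show ?thesis unfolding tau_sector[OF assms] by (simp add: algebra_simps)
qed

lemma tau_orbit:
  assumes "\<And>l. l < n \<Longrightarrow> has_support c ((tau c ^^ l) p) (j + (int l + 1) * int k)"
  shows "(tau c ^^ n) p = w ^ n * q + (- 1) ^ n * (p - q)"
  using assms
proof (induction n)
  case (Suc n)
  then have "(tau c ^^ n) p = w ^ n * q + (- 1) ^ n * (p - q)" by simp
  moreover have "has_support c ((tau c ^^ n) p) (j + (int n + 1) * int k)" using Suc.prems by simp
  ultimately show ?case using tau_step[of n "p - q"] by (simp add: has_support_iff)
qed simp

lemma constant_step_iff:
  "constant_step c j k p \<longleftrightarrow> (\<forall>n. q + cnj \<zeta> ^ n * (p - q) \<in> sector (j + int k))"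
proof
  assume "constant_step c j k p"
  then have "has_support c ((tau c ^^ n) p) (j + (int n + 1) * int k)" for n
    by (simp add: constant_step_def)
  then show "\<forall>n. q + cnj \<zeta> ^ n * (p - q) \<in> sector (j + int k)"
    using tau_orbit by (metis has_support_iff orbit_rotate)
next
  assume *: "\<forall>n. q + cnj \<zeta> ^ n * (p - q) \<in> sector (j + int k)"
  have "has_support c ((tau c ^^ n) p) (j + (int n + 1) * int k)" for n
  proof (induction n rule: less_induct)
    case (less n)
    then show ?case using tau_orbit[of n p] * by (simp add: has_support_iff orbit_rotate)
  qed
  then show "constant_step c j k p"
    unfolding constant_step_def tau_domain_eq by (auto simp: has_support_iff)
qed

text \<open>The rotations of the offset have finite order, so the condition at time \<open>2 * N - 1\<close> is the
  condition at time \<open>- 1\<close>: the reflection of \<open>p\<close> in \<open>c j\<close> has support vertex \<open>c j\<close>.\<close>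

lemma constant_step_imp_step_region:
  assumes "constant_step c j k p" shows "p \<in> step_region c j k"
proof -
  have "cnj \<zeta> * \<zeta> = 1" using w_cnj by (simp add: \<zeta>_def)
  have "cnj \<zeta> ^ (2 * N) = 1" using \<zeta>_root by (metis complex_cnj_power complex_cnj_one)
  then have "cnj \<zeta> ^ (2 * N - 1) * (cnj \<zeta> * \<zeta>) = \<zeta>"
    using N by (cases "2 * N") (auto simp: mult_ac)
  then have inv: "cnj \<zeta> ^ (2 * N - 1) = \<zeta>" using \<open>cnj \<zeta> * \<zeta> = 1\<close> by simp
  have "c (j + int k) = w * c j" using c_add[of j "int k"] by (simp add: w_def)
  then have "cnj w * w * (2 * c j) = cnj w * ((1 + w) * q)" using q by (simp add: mult_ac)
  also have "\<dots> = cnj w * q + cnj w * w * q" by (simp add: algebra_simps)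
  finally have cj: "2 * c j = cnj w * q + q" by (simp add: w_cnj)
  have "w * (2 * c j - p) = cnj w * w * q - w * (p - q)" unfolding cj by (simp add: algebra_simps)
  then have "w * (2 * c j - p) = q + \<zeta> * (p - q)" by (simp add: w_cnj \<zeta>_def)
  moreover have "q + cnj \<zeta> ^ (2 * N - 1) * (p - q) \<in> sector (j + int k)"
    using assms constant_step_iff by blast
  ultimately have "w * (2 * c j - p) \<in> sector (j + int k)" by (simp only: inv)
  then have "2 * c j - p \<in> sector j" using sector_rotate[of "int k" _ j] by (simp add: w_def)
  then have "has_inv_support c p j" by (simp add: has_inv_support_iff sector_def side_reflect)
  moreover have "has_support c p (j + int k)"
    using assms unfolding constant_step_def by (metis funpow_0 of_nat_0 add_0 mult_1)
  ultimately show ?thesis by (simp add: step_region_def inv_component_def)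
qed

text \<open>Since \<open>q\<close> is equidistant from the two lines bounding its sector, the conditions on the offset for
  all times are half-planes at the common distance \<open>r\<close>, whose normals form the orbit of two vectors
  under \<open>\<zeta> = - w\<close>. The angle of \<open>w\<close> is not a multiple of \<open>\<pi>\<close>, so they bound a polygon.\<close>

lemma tile_polygon:
  assumes r: "r > 0" "side (j + int k - 1) q = r" "side (j + int k) q = - r" and sin: "sin (2 * \<alpha> * real k) \<noteq> 0"
  shows "q \<in> tile c j k" "open_convex_polygon (tile c j k)" "center (tile c j k) = q"
    "(tau c ^^ N) ` tile c j k = tile c j k"
proof -
  define a where "a = - normal (j + int k - 1)"
  define b where "b = normal (j + int k)"
  define V where "V = (\<Union>n. {\<zeta> ^ n * a, \<zeta> ^ n * b})"
  define S where "S = {p. \<forall>v\<in>V. inner v (p - q) < r}"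
  have n\<zeta>: "norm \<zeta> = 1" by (simp add: \<zeta>_def w_def)
  have im: "Im \<zeta> \<noteq> 0" using sin by (simp add: \<zeta>_def w_def mult_ac)
  have "finite V"
  proof -
    have "\<zeta> ^ n = \<zeta> ^ (n mod (2 * N))" for n
      by (metis \<zeta>_root mult_1 power_mult power_add power_one mult_div_mod_eq)
    then have "{\<zeta> ^ n * a, \<zeta> ^ n * b} = {\<zeta> ^ (n mod (2 * N)) * a, \<zeta> ^ (n mod (2 * N)) * b}" for n by metis
    moreover have "n mod (2 * N) \<in> {..<2 * N}" for n using N by simp
    ultimately have "V \<subseteq> (\<Union>n\<in>{..<2 * N}. {\<zeta> ^ n * a, \<zeta> ^ n * b})"
      unfolding V_def by blast
    then show ?thesis by (rule finite_subset) auto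
  qed
  have unit: "norm v = 1" if "v \<in> V" for v
    using that n\<zeta> by (auto simp: V_def a_def b_def norm_mult norm_power norm_normal)
  have inv: "\<zeta> * v \<in> V" if "v \<in> V" for v
    using that unfolding V_def by (auto simp: mult.assoc[symmetric] simp flip: power_Suc)
  have "V \<noteq> {}" by (auto simp: V_def)
  note poly = rotation_invariant_polygon[OF \<open>finite V\<close> \<open>V \<noteq> {}\<close> unit inv _ \<zeta>_root n\<zeta> im r(1), of q, folded S_def]
  have adj: "inner u (cnj \<zeta> ^ n * d) = inner (\<zeta> ^ n * u) d" for u d n
    by (simp add: inner_complex_def algebra_simps flip: complex_cnj_power)
  have "q + cnj \<zeta> ^ n * d \<in> sector (j + int k) \<longleftrightarrow> inner (\<zeta> ^ n * a) d < r \<and> inner (\<zeta> ^ n * b) d < r" for n d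
    using r(2,3) by (auto simp: sector_def side_def inner_add_right adj a_def b_def)
  then have "constant_step c j k p \<longleftrightarrow> p \<in> S" for p
    by (auto simp: constant_step_iff S_def V_def)
  then have tile: "tile c j k = S" using constant_step_imp_step_region by (auto simp: tile_def)
  show "q \<in> tile c j k" using r by (simp add: tile S_def)
  show "open_convex_polygon (tile c j k)" "center (tile c j k) = q"
    using poly(2,3) N by (simp_all add: tile)
  have "(\<lambda>p. q + \<zeta> ^ n * (p - q)) ` S = S" for n
  proof (induction n)
    case (Suc n)
    have "(\<lambda>p. q + \<zeta> ^ Suc n * (p - q)) = (\<lambda>p. q + \<zeta> * (p - q)) \<circ> (\<lambda>p. q + \<zeta> ^ n * (p - q))"
      by (auto simp: mult.assoc)
    then show ?case using Suc poly(1) N by (simp only: image_comp[symmetric])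
  qed simp
  moreover have "(tau c ^^ N) p = q + \<zeta> ^ N * (p - q)" if "p \<in> S" for p
  proof -
    have "(tau c ^^ N) p = w ^ N * q + (- 1) ^ N * (p - q)"
      using that tile by (intro tau_orbit) (auto simp: tile_def constant_step_def)
    moreover have "\<zeta> ^ N = (- 1) ^ N * w ^ N" unfolding \<zeta>_def by (simp flip: power_mult_distrib)
    ultimately show ?thesis using w_root by simp
  qed
  ultimately show "(tau c ^^ N) ` tile c j k = tile c j k" by (metis (no_types, lifting) image_cong tile)
qed

end
end

section \<open>The polygon standing on its bottom edge\<close>

text \<open>The condition on \<open>\<theta>\<close> says that the outward normal of the edge from \<open>c (j - 1)\<close> to \<open>c j\<close> points
  straight down.\<close>

locale standing_polygon = regular_vertices +
  fixes j :: int
  assumes alpha_pos: "0 < \<alpha>" and theta: "\<theta> = 2 * \<alpha> * (of_int j - 1) + \<alpha> - pi / 2"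
begin

lemma pos_mult_nonneg: "0 < a \<Longrightarrow> 0 \<le> a * b \<longleftrightarrow> 0 \<le> b" for a b :: real
  by (simp add: zero_le_mult_iff)

lemma pos_mult_nonpos: "0 < a \<Longrightarrow> a * b \<le> 0 \<longleftrightarrow> b \<le> 0" for a b :: real
  by (simp add: mult_le_0_iff)

lemma alpha_eq: "\<alpha> = pi / real N" using alpha alpha_pos by simp

lemma alpha_N: "\<alpha> * real N = pi" using N by (simp add: alpha_eq)

lemma alpha_less: "\<alpha> * real k < pi / 2" if "2 * k < N"
  using that N by (simp add: alpha_eq field_simps flip: of_nat_mult)

lemma alpha_ge: "pi / 2 \<le> \<alpha> * real k" if "\<not> 2 * k < N"
proof -
  have "\<alpha> * real N \<le> \<alpha> * real (2 * k)" using that alpha_pos by (intro mult_left_mono) auto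
  then show ?thesis by (simp add: alpha_N)
qed

lemma alpha_greater: "- (pi / 2) < \<alpha> * real k"
proof -
  have "0 \<le> \<alpha> * real k" using alpha_pos by simp
  then show ?thesis using pi_gt_zero by linarith
qed

lemma cos_pos: "0 < cos (\<alpha> * real k)" if "2 * k < N"
proof (rule cos_gt_zero_pi)
  show "- (pi / 2) < \<alpha> * real k" by (rule alpha_greater)
qed (rule alpha_less[OF that])

lemma sin_pos: "0 < sin (\<alpha> * real k)" if "0 < k" "k < N"
proof (rule sin_gt_zero)
  show "0 < \<alpha> * real k" using that alpha_pos by simp
  have "\<alpha> * real k < \<alpha> * real N" using that alpha_pos by (intro mult_strict_left_mono) auto
  then show "\<alpha> * real k < pi" using N by (simp add: alpha_eq)
qed

lemma sin_alpha_pos: "0 < sin \<alpha>" using sin_pos[of 1] N by simp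

lemma tan_less: "tan (\<alpha> * real k) < tan (\<alpha> * real l)" if "k < l" "2 * l < N"
proof (rule tan_monotone)
  show "- (pi / 2) < \<alpha> * real k" by (rule alpha_greater)
  show "\<alpha> * real k < \<alpha> * real l" using that alpha_pos by simp
qed (use alpha_less that in auto)

lemma vertex_polar: "c (j + l) = of_real R * cis (- pi / 2 - \<alpha> - 2 * \<alpha> * of_int l)"
proof -
  have "\<theta> - 2 * \<alpha> * of_int (j + l) = - pi / 2 - \<alpha> - 2 * \<alpha> * of_int l"
    by (simp add: theta algebra_simps)
  then show ?thesis by (simp only: c_eq)
qed

lemma vertex_j: "c j = Complex (- R * sin \<alpha>) (- R * cos \<alpha>)"
  using vertex_polar[of 0] by (simp add: complex_eq_iff sin_diff cos_diff)

lemma vertex_j': "c (j - 1) = Complex (R * sin \<alpha>) (- R * cos \<alpha>)"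
proof -
  have "- pi / 2 - \<alpha> - 2 * \<alpha> * of_int (-1) = \<alpha> - pi / 2" by simp
  then have "c (j - 1) = of_real R * cis (\<alpha> - pi / 2)" using vertex_polar[of "-1"] by simp
  then show ?thesis by (simp add: complex_eq_iff sin_diff cos_diff)
qed

lemma normal_polar: "normal (j - 1 + l) = cis (- pi / 2 - 2 * \<alpha> * of_int l)"
proof -
  have "\<theta> - 2 * \<alpha> * of_int (j - 1 + l) - \<alpha> = - pi / 2 - 2 * \<alpha> * of_int l"
    by (simp add: theta algebra_simps)
  then show ?thesis by (simp only: normal_def)
qed

lemma side_bottom_line:
  assumes "Im p = - R * cos \<alpha>"
  shows "side (j - 1 + l) p = 2 * sin (\<alpha> * of_int l) * (- Re p * cos (\<alpha> * of_int l) - R * cos \<alpha> * sin (\<alpha> * of_int l))"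
proof -
  let ?x = "\<alpha> * of_int l"
  have "normal (j - 1 + l) = Complex (- sin (2 * ?x)) (- cos (2 * ?x))"
    by (simp add: normal_polar complex_eq_iff sin_diff cos_diff mult.assoc)
  then have "side (j - 1 + l) p = - Re p * sin (2 * ?x) + R * cos \<alpha> * cos (2 * ?x) - R * cos \<alpha>"
    using assms by (simp add: side_def inner_complex_def)
  then show ?thesis
    unfolding sin_double cos_double_sin by (simp add: power2_eq_square algebra_simps)
qed

lemma extended_forward_edge_eq:
  "extended_forward_edge c j = {p. Im p = - R * cos \<alpha> \<and> Re p \<le> - R * sin \<alpha>}"
proof -
  have Rs: "0 < R * sin \<alpha>" using R sin_alpha_pos by simp
  have "extended_forward_edge c j = {c j + t *\<^sub>R (c j - c (j - 1)) | t. t \<ge> 0}" (is "?L = ?M")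
  proof
    show "?L \<subseteq> ?M" unfolding extended_forward_edge_def forward_ext_def
      by (auto intro: less_imp_le exI[of _ 0])
    show "?M \<subseteq> ?L" unfolding extended_forward_edge_def forward_ext_def
      by (auto simp: le_less)
  qed
  also have "\<dots> = {p. Im p = - R * cos \<alpha> \<and> Re p \<le> - R * sin \<alpha>}" (is "_ = ?T")
  proof
    show "?M \<subseteq> ?T" using Rs by (auto simp: vertex_j vertex_j' mult_nonneg_nonneg)
    show "?T \<subseteq> ?M"
    proof
      fix p assume p: "p \<in> ?T"
      define t where "t = (- Re p - R * sin \<alpha>) / (2 * (R * sin \<alpha>))"
      have "t \<ge> 0" using p Rs unfolding t_def by (intro divide_nonneg_pos) auto
      moreover have "t * (2 * (R * sin \<alpha>)) = - Re p - R * sin \<alpha>"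
        unfolding t_def using Rs by (metis nonzero_eq_divide_eq less_irrefl mult_pos_pos zero_less_numeral)
      then have "p = c j + t *\<^sub>R (c j - c (j - 1))"
        using p by (simp add: complex_eq_iff vertex_j vertex_j' algebra_simps)
      ultimately show "p \<in> ?M" by blast
    qed
  qed
  finally show ?thesis .
qed

text \<open>Two tangents of a circle of radius \<open>a\<close> whose points of contact are an angle \<open>2 * x\<close> apart meet at distance
  \<open>a * tan x\<close> from these points; here the tangents are the lines of the edges \<open>j - 1\<close> and
  \<open>j - 1 + k\<close>.\<close>

definition star :: "nat \<Rightarrow> complex" where
  "star k = Complex (- R * cos \<alpha> * tan (\<alpha> * real k)) (- R * cos \<alpha>)"

text \<open>The solution \<open>q\<close> of \<open>(1 + w) * q = 2 * c (j + k)\<close>, where \<open>1 + w = 2 * cos (\<alpha> * k) * cis (- \<alpha> * k)\<close>.\<close>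

definition tile_center :: "nat \<Rightarrow> complex" where
  "tile_center k = of_real (R / cos (\<alpha> * real k)) * cis (- pi / 2 - \<alpha> * (real k + 1))"

lemma star_1: "star 1 = c j"
  using cos_alpha_pos by (simp add: star_def vertex_j tan_def)

lemma star_edge: assumes "1 \<le> k" "2 * k < N" shows "star k \<in> extended_forward_edge c j"
proof -
  have "tan \<alpha> \<le> tan (\<alpha> * real k)"
    using tan_less[of 1 k] assms by (cases "k = 1") auto
  then have "R * cos \<alpha> * tan \<alpha> \<le> R * cos \<alpha> * tan (\<alpha> * real k)"
    using R cos_alpha_pos by (intro mult_left_mono) auto
  moreover have "R * cos \<alpha> * tan \<alpha> = R * sin \<alpha>" using cos_alpha_pos by (simp add: tan_def)
  ultimately show ?thesis by (simp add: extended_forward_edge_eq star_def)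
qed

lemma side_sign_bottom_line:
  assumes p: "Im p = - R * cos \<alpha>" and k: "1 \<le> k" "2 * k < N"
  shows "side (j - 1 + int k) p = 2 * sin (\<alpha> * real k) * cos (\<alpha> * real k) * (Re (star k) - Re p)"
proof -
  have "- R * cos \<alpha> * sin (\<alpha> * real k) = cos (\<alpha> * real k) * Re (star k)"
    using cos_pos[OF k(2)] by (simp add: star_def tan_def)
  then have "- Re p * cos (\<alpha> * real k) - R * cos \<alpha> * sin (\<alpha> * real k) = cos (\<alpha> * real k) * (Re (star k) - Re p)"
    by (simp add: algebra_simps)
  then show ?thesis using side_bottom_line[OF p, of "int k"] by simp
qed

text \<open>On the line of the bottom edge, \<open>side_bottom_line\<close> factors the signed distance. Since a point left
  of \<open>c j\<close> has negative abscissa, a zero forces \<open>cos (\<alpha> * k) > 0\<close>, which limits \<open>k\<close>.\<close>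

lemma star_points_eq: "star_points c j = star ` {k. 1 \<le> k \<and> 2 * k < N}"
proof
  show "star_points c j \<subseteq> star ` {k. 1 \<le> k \<and> 2 * k < N}"
  proof
    fix p assume "p \<in> star_points c j"
    then obtain i where p: "p \<in> extended_forward_edge c j" and i: "p \<in> insert (c i) (trailing_ext c i)"
      by (auto simp: star_points_def)
    have im: "Im p = - R * cos \<alpha>" "Re p \<le> - R * sin \<alpha>" using p by (auto simp: extended_forward_edge_eq)
    have "0 < R * sin \<alpha>" using R sin_alpha_pos by simp
    then have "Re p < 0" using im by simp
    have sides: "side i p = 0" "side (i - 1) p \<ge> 0"
      using i side_vertex_same[of i] unfolding trailing_ext_eq by auto
    define k where "k = nat ((i - (j - 1)) mod int N)"
    have k: "k < N" "int k = (i - (j - 1)) mod int N" using N by (auto simp: k_def nat_less_iff)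
    have ik: "i = (j - 1 + int k) + int N * ((i - (j - 1)) div int N)"
      unfolding k(2) by (simp add: algebra_simps)
    then have "side i = side (j - 1 + int k)" by (metis side_periodic)
    moreover have "i - 1 = (j - 1 + (int k - 1)) + int N * ((i - (j - 1)) div int N)" using ik by simp
    then have "side (i - 1) = side (j - 1 + (int k - 1))" by (metis side_periodic)
    ultimately have s: "side (j - 1 + int k) p = 0" "side (j - 1 + (int k - 1)) p \<ge> 0" using sides by auto
    have "k \<noteq> 0"
    proof
      assume "k = 0"
      have "- Re p * cos \<alpha> + R * cos \<alpha> * sin \<alpha> > 0"
        using cos_alpha_pos R sin_alpha_pos \<open>Re p < 0\<close> by (intro add_pos_pos) (auto intro!: mult_neg_pos mult_pos_pos)
      then have "0 < 2 * sin \<alpha> * (- Re p * cos \<alpha> + R * cos \<alpha> * sin \<alpha>)"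
        using sin_alpha_pos by simp
      then show False
        using side_bottom_line[OF im(1), of "-1"] s(2) \<open>k = 0\<close> by simp
    qed
    then have "sin (\<alpha> * real k) > 0" using k sin_pos by simp
    then have eq: "- Re p * cos (\<alpha> * real k) = R * cos \<alpha> * sin (\<alpha> * real k)"
      using s(1) side_bottom_line[OF im(1), of "int k"] by simp
    have "- Re p > 0" using \<open>Re p < 0\<close> by simp
    moreover have "R * cos \<alpha> * sin (\<alpha> * real k) > 0"
      using R cos_alpha_pos \<open>sin (\<alpha> * real k) > 0\<close> by simp
    ultimately have cos: "cos (\<alpha> * real k) > 0" using eq by (metis zero_less_mult_pos)
    have "2 * k < N"
    proof (rule ccontr)
      assume "\<not> 2 * k < N"
      then have "pi / 2 \<le> \<alpha> * real k" using alpha_ge by blast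
      moreover have "\<alpha> * real k \<le> pi" using k N by (simp add: alpha_eq field_simps)
      ultimately have "cos (\<alpha> * real k) \<le> 0" using cos_monotone_0_pi_le[of "pi / 2" "\<alpha> * real k"] by simp
      then show False using cos by simp
    qed
    moreover have "p = star k"
      using im eq cos by (simp add: star_def complex_eq_iff tan_def field_simps)
    ultimately show "p \<in> star ` {k. 1 \<le> k \<and> 2 * k < N}" using \<open>k \<noteq> 0\<close> by auto
  qed
  show "star ` {k. 1 \<le> k \<and> 2 * k < N} \<subseteq> star_points c j"
  proof safe
    fix k assume k: "1 \<le> k" "2 * k < N"
    have im: "Im (star k) = - R * cos \<alpha>" by (simp add: star_def)
    have "star k \<in> insert (c (j - 1 + int k)) (trailing_ext c (j - 1 + int k))"
    proof (cases "k = 1")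
      case True then show ?thesis using star_1 by simp
    next
      case False
      then obtain l where l: "k = Suc l" "1 \<le> l" "2 * l < N" using k by (cases k) auto
      have "side (j - 1 + int k) (star k) = 0" using side_sign_bottom_line[OF im k] by simp
      moreover have "Re (star l) - Re (star k) > 0"
        using tan_less[of l k] l k R cos_alpha_pos by (simp add: star_def)
      then have "side (j - 1 + int l) (star k) > 0"
        using side_sign_bottom_line[OF im l(2,3)] sin_pos[of l] cos_pos[of l] l by simp
      moreover have "j - 1 + int k - 1 = j - 1 + int l" using l by simp
      ultimately show ?thesis unfolding trailing_ext_eq by (metis (mono_tags, lifting) insertCI mem_Collect_eq)
    qed
    then show "star k \<in> star_points c j" using star_edge[OF k] by (auto simp: star_points_def)
  qed
qed

lemma tile_center_coordinates:
  assumes "2 * k < N"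
  shows "Re (tile_center k) = - R * sin \<alpha> - R * cos \<alpha> * tan (\<alpha> * real k)"
    "Im (tile_center k) = - R * cos \<alpha> + R * sin \<alpha> * tan (\<alpha> * real k)"
proof -
  have "Re (tile_center k) = - R * sin (\<alpha> * real k + \<alpha>) / cos (\<alpha> * real k)"
    "Im (tile_center k) = - R * cos (\<alpha> * real k + \<alpha>) / cos (\<alpha> * real k)"
    by (simp_all add: tile_center_def distrib_left sin_diff cos_diff)
  then show "Re (tile_center k) = - R * sin \<alpha> - R * cos \<alpha> * tan (\<alpha> * real k)"
    "Im (tile_center k) = - R * cos \<alpha> + R * sin \<alpha> * tan (\<alpha> * real k)"
    using cos_pos[OF assms] by (simp_all add: sin_add cos_add tan_def field_simps)
qed

lemma tile_center_fixed:
  assumes "2 * k < N"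
  shows "(1 + cis (- 2 * \<alpha> * real k)) * tile_center k = 2 * c (j + int k)"
proof -
  let ?x = "\<alpha> * real k"
  have "1 + cis (- 2 * ?x) = cis (- ?x) * (cis ?x + cis (- ?x))"
    by (simp add: distrib_left cis_mult)
  also have "cis ?x + cis (- ?x) = of_real (2 * cos ?x)" by (simp add: complex_eq_iff)
  finally have 1: "1 + cis (- 2 * \<alpha> * real k) = cis (- ?x) * of_real (2 * cos ?x)" by (simp add: mult.assoc)
  have "of_real (2 * cos ?x) * tile_center k = of_real (2 * R) * cis (- pi / 2 - \<alpha> * (real k + 1))"
    using cos_pos[OF assms] unfolding tile_center_def by (simp add: complex_eq_iff)
  then have "(1 + cis (- 2 * \<alpha> * real k)) * tile_center k =
      of_real (2 * R) * (cis (- ?x) * cis (- pi / 2 - \<alpha> * (real k + 1)))"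
    unfolding 1 by (metis mult.assoc mult.left_commute)
  also have "\<dots> = 2 * c (j + int k)"
  proof -
    have "- ?x + (- pi / 2 - \<alpha> * (real k + 1)) = - pi / 2 - \<alpha> - 2 * \<alpha> * of_int (int k)"
      by (simp add: algebra_simps)
    then show ?thesis by (simp only: vertex_polar cis_mult) simp
  qed
  finally show ?thesis .
qed

lemma side_tile_center:
  assumes "2 * k < N"
  shows "side (j + int k - 1) (tile_center k) = R * sin \<alpha> * tan (\<alpha> * real k)"
    "side (j + int k) (tile_center k) = - (R * sin \<alpha> * tan (\<alpha> * real k))"
proof -
  let ?x = "\<alpha> * real k"
  have gen: "side (j - 1 + l) (tile_center k) = R / cos ?x * cos (?x + \<alpha> - 2 * \<alpha> * of_int l) - R * cos \<alpha>" for l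
  proof -
    have "inner (normal (j - 1 + l)) (tile_center k) =
        R / cos ?x * inner (normal (j - 1 + l)) (cis (- pi / 2 - \<alpha> * (real k + 1)))"
      unfolding tile_center_def by (simp add: inner_complex_def algebra_simps add_divide_distrib)
    then show ?thesis unfolding side_def normal_polar inner_cis by (simp add: algebra_simps)
  qed
  have "?x + \<alpha> - 2 * \<alpha> * of_int (int k) = \<alpha> - ?x" "?x + \<alpha> - 2 * \<alpha> * of_int (int k + 1) = - (\<alpha> + ?x)"
    by (simp_all add: algebra_simps)
  then have "side (j - 1 + int k) (tile_center k) = R / cos ?x * cos (\<alpha> - ?x) - R * cos \<alpha>"
    "side (j - 1 + (int k + 1)) (tile_center k) = R / cos ?x * cos (\<alpha> + ?x) - R * cos \<alpha>"
    unfolding gen by (simp_all only: cos_minus)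
  then have *: "side (j + int k - 1) (tile_center k) = R / cos ?x * cos (\<alpha> - ?x) - R * cos \<alpha>"
    "side (j + int k) (tile_center k) = R / cos ?x * cos (\<alpha> + ?x) - R * cos \<alpha>"
    by (simp_all add: algebra_simps)
  have C: "cos ?x \<noteq> 0" using cos_pos[OF assms] by simp
  have "R / cos ?x * cos (\<alpha> - ?x) = R * cos \<alpha> + R * sin \<alpha> * tan ?x"
    "R / cos ?x * cos (\<alpha> + ?x) = R * cos \<alpha> - R * sin \<alpha> * tan ?x"
    unfolding cos_diff cos_add tan_def distrib_left right_diff_distrib using C by simp_all
  then show "side (j + int k - 1) (tile_center k) = R * sin \<alpha> * tan ?x"
    "side (j + int k) (tile_center k) = - (R * sin \<alpha> * tan ?x)"
    unfolding * by simp_all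
qed

lemma tan_pos: "0 < tan (\<alpha> * real k)" if "1 \<le> k" "2 * k < N"
  using sin_pos[of k] cos_pos[OF that(2)] that by (simp add: tan_def)

lemma tile_properties:
  assumes "1 \<le> k" "2 * k < N"
  shows "tile_center k \<in> tile c j k" "open_convex_polygon (tile c j k)" "center (tile c j k) = tile_center k"
    "(tau c ^^ N) ` tile c j k = tile c j k"
proof -
  have r: "0 < R * sin \<alpha> * tan (\<alpha> * real k)" using R sin_alpha_pos tan_pos[OF assms] by simp
  have "sin (2 * \<alpha> * real k) \<noteq> 0"
    using sin_double[of "\<alpha> * real k"] sin_pos[of k] cos_pos[of k] assms by (simp add: mult.assoc)
  from tile_polygon[OF refl refl tile_center_fixed[OF assms(2)] r side_tile_center[OF assms(2)] this]
  show "tile_center k \<in> tile c j k" "open_convex_polygon (tile c j k)" "center (tile c j k) = tile_center k"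
    "(tau c ^^ N) ` tile c j k = tile c j k" .
qed

lemma step_region_eq: "step_region c j k = cell {j, j + int k - 1} {j - 1, j + int k}"
  by (auto simp: step_region_def inv_component_def has_inv_support_iff has_support_iff sector_def cell_def)

lemma step_region_component:
  assumes "1 \<le> k" "2 * k < N"
  shows "step_region c j k \<in> components (inv_component c j - (\<Union>i. trailing_ext c i))"
proof -
  let ?U = "cell {j} {j - 1}"
  let ?F = "range (\<lambda>i. ?U \<inter> sector i)"
  have U: "inv_component c j = ?U"
    by (auto simp: inv_component_def has_inv_support_iff cell_def)
  have "?U \<inter> polygon c = {}" unfolding cell_def polygon_eq by (auto simp: disjoint_iff not_le intro!: exI[of _ j])
  then have "?U - (\<Union>i. trailing_ext c i) = ?U \<inter> tau_domain c"
    by (auto simp: tau_domain_def)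
  also have "\<dots> = \<Union>?F" by (auto simp: tau_domain_eq)
  finally have "components (?U - (\<Union>i. trailing_ext c i)) = ?F - {{}}"
  proof (rule components_of_disjoint_open_cover)
    fix S T assume "S \<in> ?F" "T \<in> ?F" "S \<noteq> T"
    then obtain i l where il: "S = ?U \<inter> sector i" "T = ?U \<inter> sector l" "sector i \<noteq> sector l" by auto
    then show "S \<inter> T = {}" using sector_disjoint_or_eq[of i l] by auto
  next
    fix T assume "T \<in> ?F"
    then show "open T" by (auto intro: open_Int open_cell open_sector)
  next
    fix T assume "T \<in> ?F"
    then show "connected T" by (auto intro!: convex_connected convex_Int convex_cell convex_sector)
  qed
  moreover have "step_region c j k = ?U \<inter> sector (j + int k)"
    by (auto simp: step_region_eq sector_def cell_def)
  moreover have "step_region c j k \<noteq> {}"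
    using tile_properties(1)[OF assms] by (auto simp: tile_def)
  ultimately show ?thesis unfolding U by blast
qed

text \<open>The two cases differ in the sign of \<open>cos (\<alpha> * (k + 1))\<close>. When it is not positive, the line of the
  edge \<open>j + k\<close> does not meet the bottom line on the left, and the region is unbounded there.\<close>

lemma closure_step_region_edge:
  assumes k: "1 \<le> k" "2 * k < N"
  shows "closure (step_region c j k) \<inter> extended_forward_edge c j =
    (if 2 * (k + 1) < N then closed_segment (star k) (star (k + 1))
     else {p \<in> extended_forward_edge c j. Re p \<le> Re (star k)})"
proof -
  have "step_region c j k \<noteq> {}"
    using tile_properties(1)[OF k] by (auto simp: tile_def)
  then have cl: "closure (step_region c j k) =
      {p. side j p \<ge> 0 \<and> side (j + int k - 1) p \<ge> 0 \<and> side (j - 1) p \<le> 0 \<and> side (j + int k) p \<le> 0}"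
    unfolding step_region_eq by (subst closure_cell) auto
  have mem: "p \<in> closure (step_region c j k) \<longleftrightarrow>
      Re p \<le> Re (star k) \<and> (2 * (k + 1) < N \<longrightarrow> Re (star (k + 1)) \<le> Re p)"
    if p: "p \<in> extended_forward_edge c j" for p
  proof -
    have im: "Im p = - R * cos \<alpha>" and re: "Re p \<le> - R * sin \<alpha>"
      using p by (auto simp: extended_forward_edge_eq)
    have idx: "j - 1 + int k = j + int k - 1" "j - 1 + int (k + 1) = j + int k" "j - 1 + int 1 = j" by simp_all
    have sign: "side (j - 1 + int l) p \<ge> 0 \<longleftrightarrow> Re p \<le> Re (star l)"
      "side (j - 1 + int l) p \<le> 0 \<longleftrightarrow> Re (star l) \<le> Re p" if l: "1 \<le> l" "2 * l < N" for l
    proof -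
      have "0 < 2 * sin (\<alpha> * real l) * cos (\<alpha> * real l)"
        using sin_pos[of l] cos_pos[of l] l by simp
      then show "side (j - 1 + int l) p \<ge> 0 \<longleftrightarrow> Re p \<le> Re (star l)"
        "side (j - 1 + int l) p \<le> 0 \<longleftrightarrow> Re (star l) \<le> Re p"
        unfolding side_sign_bottom_line[OF im l] by (simp_all only: pos_mult_nonneg pos_mult_nonpos) auto
    qed
    have "side (j - 1) p = 0" using side_bottom_line[OF im, of 0] by simp
    moreover have "side j p \<ge> 0"
      using sign(1)[of 1] N re star_1 unfolding idx by (simp add: vertex_j)
    moreover have "side (j + int k - 1) p \<ge> 0 \<longleftrightarrow> Re p \<le> Re (star k)"
      using sign(1)[OF k] unfolding idx .
    moreover have "side (j + int k) p \<le> 0 \<longleftrightarrow> (2 * (k + 1) < N \<longrightarrow> Re (star (k + 1)) \<le> Re p)"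
    proof (cases "2 * (k + 1) < N")
      case True then show ?thesis using sign(2)[of "k + 1"] unfolding idx by simp
    next
      case False
      let ?y = "\<alpha> * real (k + 1)"
      have "pi / 2 \<le> ?y" using alpha_ge False by blast
      moreover have "\<alpha> * real (k + 1) \<le> \<alpha> * real N"
        using k alpha_pos by (intro mult_left_mono) auto
      then have "?y \<le> pi" by (simp only: alpha_N)
      ultimately have "cos ?y \<le> 0" using cos_monotone_0_pi_le[of "pi / 2" ?y] by simp
      moreover have "0 < R * sin \<alpha>" using R sin_alpha_pos by simp
      then have "Re p \<le> 0" using re by simp
      ultimately have "- Re p * cos ?y \<le> 0" by (simp add: mult_nonneg_nonpos mult_nonpos_nonpos)
      moreover have sin: "sin ?y > 0" using sin_pos[of "k + 1"] k N by simp
      moreover have "R * cos \<alpha> * sin ?y > 0" using R cos_alpha_pos sin by simp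
      ultimately have "2 * sin ?y * (- Re p * cos ?y - R * cos \<alpha> * sin ?y) \<le> 0"
        by (intro mult_nonneg_nonpos) auto
      then show ?thesis using False side_bottom_line[OF im, of "int (k + 1)"] unfolding idx by simp
    qed
    ultimately show ?thesis by (simp add: cl)
  qed
  show ?thesis
  proof (cases "2 * (k + 1) < N")
    case True
    have "Re (star (k + 1)) \<le> Re (star k)"
      using tan_less[of k "k + 1"] True R cos_alpha_pos by (simp add: star_def)
    then have "closed_segment (star k) (star (k + 1)) =
        {p. Im p = - R * cos \<alpha> \<and> Re (star (k + 1)) \<le> Re p \<and> Re p \<le> Re (star k)}"
      by (subst closed_segment_same_Im) (auto simp: star_def closed_segment_eq_real_ivl)
    also have "\<dots> = closure (step_region c j k) \<inter> extended_forward_edge c j"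
      using mem True star_edge[OF k] by (auto simp: extended_forward_edge_eq)
    finally show ?thesis using True by simp
  next
    case False then show ?thesis using mem by auto
  qed
qed

lemma Re_star_less: "Re (star l) < Re (star k)" if "k < l" "2 * l < N"
  using tan_less[OF that] R cos_alpha_pos by (simp add: star_def)

lemma top_vertex_odd:
  assumes "N = 2 * m + 1"
  shows "top_vertex c (c (j + int m))" "Im (c (j + int m)) = R"
proof -
  have "2 * \<alpha> * real m + \<alpha> = pi"
    using alpha_N by (simp add: assms algebra_simps)
  then have "- pi / 2 - \<alpha> - 2 * \<alpha> * of_int (int m) = - pi / 2 + - pi" by simp
  then have "c (j + int m) = of_real R * (cis (- pi / 2) * cis (- pi))"
    unfolding vertex_polar cis_mult by (simp only:)
  then have top: "c (j + int m) = \<i> * R" by (simp add: complex_eq_iff)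
  then show "Im (c (j + int m)) = R" by simp
  have "Im (c l) < R" if "c l \<noteq> \<i> * R" for l
  proof -
    have norm: "norm (c l) = R" using R by (simp add: c_eq norm_mult)
    then have *: "(Re (c l))\<^sup>2 + (Im (c l))\<^sup>2 = R\<^sup>2" by (metis cmod_power2)
    have "Im (c l) \<le> R" using abs_Im_le_cmod[of "c l"] norm by simp
    moreover have "Im (c l) \<noteq> R" using * that by (auto simp: complex_eq_iff)
    ultimately show ?thesis by simp
  qed
  then show "top_vertex c (c (j + int m))"
    unfolding top_vertex_def by (intro conjI rangeI) (auto simp: top)
qed

text \<open>The angle \<open>\<alpha> * (m + 1)\<close> is supplementary to \<open>\<alpha> * m\<close> for odd \<open>N\<close> and a right angle for even \<open>N\<close>.\<close>

lemma Im_tile_center_last: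
  "N = 2 * m + 1 \<Longrightarrow> Im (tile_center m) = R"
  "N = 2 * m + 2 \<Longrightarrow> Im (tile_center m) = 0"
proof -
  have Im: "Im (tile_center m) = - R * cos (\<alpha> * real m + \<alpha>) / cos (\<alpha> * real m)"
    by (simp add: tile_center_def distrib_left sin_diff)
  show "Im (tile_center m) = R" if "N = 2 * m + 1"
  proof -
    have "\<alpha> * real m + \<alpha> = pi - \<alpha> * real m" using alpha_N by (simp add: that algebra_simps)
    then show ?thesis unfolding Im using cos_pos[of m] that by (simp only: cos_pi_minus) simp
  qed
  show "Im (tile_center m) = 0" if "N = 2 * m + 2"
  proof -
    have "\<alpha> * real m + \<alpha> = pi / 2" using alpha_N by (simp add: that algebra_simps)
    then show ?thesis unfolding Im by (simp only: cos_pi_half)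
  qed
qed

text \<open>By \<open>tile_center_coordinates\<close> the displacement of \<open>tile_center k\<close> from \<open>star 1\<close> is \<open>tan (\<alpha> * k)\<close>
  times a fixed vector that is not vertical.\<close>

lemma centers_line:
  assumes m: "1 \<le> m" "2 * m < N"
  defines "L \<equiv> affine hull {star 1, tile_center m}"
  shows "star 1 \<noteq> tile_center m"
    and "1 \<le> k \<Longrightarrow> 2 * k < N \<Longrightarrow> tile_center k \<in> L"
    and "1 \<le> k \<Longrightarrow> 2 * k < N \<Longrightarrow> L \<inter> {z. Re z = Re (tile_center k)} = {tile_center k}"
proof -
  let ?d = "Complex (- R * cos \<alpha>) (R * sin \<alpha>)"
  define f where "f t = star 1 + t *\<^sub>R ?d" for t
  have cen: "tile_center k = f (tan (\<alpha> * real k))" if "2 * k < N" for k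
    using tile_center_coordinates[OF that] unfolding f_def star_1 vertex_j by (simp add: complex_eq_iff)
  have Rc: "R * cos \<alpha> > 0" using R cos_alpha_pos by simp
  let ?T = "tan (\<alpha> * real m)"
  have T: "?T > 0" using tan_pos[OF m] .
  have inj: "t = u" if "Re (f t) = Re (f u)" for t u using that Rc by (auto simp: f_def)
  have "f 0 \<noteq> f ?T" using inj[of 0 ?T] T by auto
  then show "star 1 \<noteq> tile_center m" unfolding cen[OF m(2)] by (simp add: f_def)
  have L: "L = range f"
  proof
    have L: "L = range (\<lambda>u. star 1 + u *\<^sub>R (?T *\<^sub>R ?d))"
      unfolding L_def affine_hull_2_alt cen[OF m(2)] f_def by simp
    then show "L \<subseteq> range f" unfolding f_def by auto
    have "f t = star 1 + (t / ?T) *\<^sub>R (?T *\<^sub>R ?d)" for t using T by (simp add: f_def)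
    then show "range f \<subseteq> L" unfolding L by blast
  qed
  show "tile_center k \<in> L" if "1 \<le> k" "2 * k < N" using cen[OF that(2)] L by simp
  show "L \<inter> {z. Re z = Re (tile_center k)} = {tile_center k}" if "1 \<le> k" "2 * k < N"
    unfolding cen[OF that(2)] L using inj by auto
qed

end
lemma standing_polygon_of_regular_polygon:
  assumes "N \<ge> 3" "s > 0" and reg: "regular_polygon N s c" and bottom: "horizontal_bottom_edge c (j - 1)"
  defines "\<alpha> \<equiv> pi / real N"
  defines "\<theta> \<equiv> 2 * \<alpha> * (of_int j - 1) + \<alpha> - pi / 2"
  obtains R where "standing_polygon N R \<theta> \<alpha> c j" "2 * R * sin \<alpha> = s"
proof -
  have cis_cis: "cis a * (cis b * x) = cis (a + b) * x" for a b x
    by (simp only: cis_mult mult.assoc[symmetric])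
  have step: "c (i + 1) = cis (- (2 * \<alpha>)) * c i" for i
    using reg by (simp add: regular_polygon_def \<alpha>_def)
  have inv: "c (i - 1) = cis (2 * \<alpha>) * c i" for i
    using step[of "i - 1"] by (simp add: cis_cis)
  have rot: "c (j + l) = cis (- 2 * \<alpha> * of_int l) * c j" for l
  proof (induction l rule: int_induct[where k = 0])
    case (step1 i)
    have "c (j + (i + 1)) = cis (- (2 * \<alpha>)) * c (j + i)" using step[of "j + i"] by (simp add: add.assoc)
    also have "\<dots> = cis (- (2 * \<alpha>) + - 2 * \<alpha> * of_int i) * c j" by (simp only: step1 cis_cis)
    also have "- (2 * \<alpha>) + - 2 * \<alpha> * of_int i = - 2 * \<alpha> * of_int (i + 1)" by (simp add: algebra_simps)
    finally show ?case .
  next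
    case (step2 i)
    have "c (j + (i - 1)) = cis (2 * \<alpha>) * c (j + i)" using inv[of "j + i"] by (simp add: add_diff_eq)
    also have "\<dots> = cis (2 * \<alpha> + - 2 * \<alpha> * of_int i) * c j" by (simp only: step2 cis_cis)
    also have "2 * \<alpha> + - 2 * \<alpha> * of_int i = - 2 * \<alpha> * of_int (i - 1)" by (simp add: algebra_simps)
    finally show ?case .
  qed simp
  define z where "z = cis \<alpha> * c j"
  have cj: "c j = cis (- \<alpha>) * z" "c (j - 1) = cis \<alpha> * z"
    unfolding z_def inv by (simp_all add: cis_cis)
  have "0 < \<alpha>" "\<alpha> < pi" using assms(1) by (auto simp: \<alpha>_def field_simps)
  then have sin: "sin \<alpha> > 0" by (rule sin_gt_zero)
  have "Im (c (j - 1)) = Im (c j)" "Re (c j) < Re (c (j - 1))"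
    using bottom by (simp_all add: horizontal_bottom_edge_def)
  then have "sin \<alpha> * Re z = 0" "sin \<alpha> * Im z < 0" unfolding cj by auto
  then have z: "Re z = 0" "Im z < 0" using sin by (auto simp: mult_less_0_iff)
  define R where "R = - Im z"
  have "z = of_real R * cis (- pi / 2)" using z by (simp add: complex_eq_iff R_def)
  then have "c j = of_real R * (cis (- pi / 2) * cis (- \<alpha>))" unfolding cj by (simp only: mult_ac)
  then have cj': "c j = of_real R * cis (- pi / 2 - \<alpha>)" by (simp only: cis_mult diff_conv_add_uminus)
  have "c i = of_real R * cis (\<theta> - 2 * \<alpha> * of_int i)" for i
  proof -
    have "c i = of_real R * (cis (- 2 * \<alpha> * of_int (i - j)) * cis (- pi / 2 - \<alpha>))"
      using rot[of "i - j"] unfolding cj' by (simp only: mult.left_commute add_diff_eq add_diff_cancel_left')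
    moreover have "- 2 * \<alpha> * of_int (i - j) + (- pi / 2 - \<alpha>) = \<theta> - 2 * \<alpha> * of_int i"
      unfolding \<theta>_def by (simp add: algebra_simps)
    ultimately show ?thesis by (simp only: cis_mult)
  qed
  then have "standing_polygon N R \<theta> \<alpha> c j"
    using assms(1) z \<open>0 < \<alpha>\<close> by unfold_locales (auto simp: R_def \<alpha>_def \<theta>_def)
  moreover have "dist (c (j - 1)) (c j) = s"
  proof -
    have "dist (c (j - 1)) (c (j - 1 + 1)) = s" using reg unfolding regular_polygon_def by blast
    then show ?thesis by simp
  qed
  then have "2 * R * sin \<alpha> = s"
  proof -
    have "c (j - 1) - c j = of_real (2 * R * sin \<alpha>)"
      unfolding cj using z by (simp add: complex_eq_iff R_def)
    then have "dist (c (j - 1)) (c j) = \<bar>2 * R * sin \<alpha>\<bar>" by (metis dist_norm norm_of_real)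
    moreover have "0 < 2 * R * sin \<alpha>" using z sin by (simp add: R_def mult_neg_pos)
    ultimately show ?thesis using \<open>dist (c (j - 1)) (c j) = s\<close> by simp
  qed
  ultimately show ?thesis using that by blast
qed

theorem mainTheorem1:
  fixes N m :: nat and s :: real and c :: "int \<Rightarrow> complex" and j :: int
  assumes "N \<ge> 3" and "s > 0"
    and "regular_polygon N s c"
    and "horizontal_bottom_edge c (j - 1)"
    and "m = (if odd N then N div 2 else N div 2 - 1)"
  shows "finite (star_points c j) \<and> card (star_points c j) = m \<and>
    (\<exists>star :: nat \<Rightarrow> complex.
       bij_betw star {1..m} (star_points c j) \<and>
       (\<forall>k l. 1 \<le> k \<and> k < l \<and> l \<le> m \<longrightarrow> Re (star l) < Re (star k)) \<and>
       star 1 = c j \<and>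
       (\<forall>k \<in> {1..m}.
          step_region c j k \<in> components (inv_component c j - (\<Union>i. trailing_ext c i)) \<and>
          closure (step_region c j k) \<inter> extended_forward_edge c j =
            (if k < m then closed_segment (star k) (star (k + 1))
             else {p \<in> extended_forward_edge c j. Re p \<le> Re (star m)}) \<and>
          open_convex_polygon (tile c j k) \<and>
          (tau c ^^ N) ` tile c j k = tile c j k \<and>
          Re (center (tile c j k)) = Re (star k) - s / 2) \<and>
       (let cD = center (tile c j m); L = affine hull {star 1, cD} in
          star 1 \<noteq> cD \<and>
          (\<forall>k \<in> {1..m}. center (tile c j k) \<in> L) \<and>
          (odd N \<longrightarrow> (\<exists>t. top_vertex c t \<and> Im cD = Im t)) \<and>
          (even N \<longrightarrow> Im cD = 0) \<and>
          (\<forall>k \<in> {1..m}. L \<inter> {z. Re z = Re (star k) - s / 2} = {center (tile c j k)})))"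
proof -
  obtain R where "standing_polygon N R (2 * (pi / real N) * (of_int j - 1) + pi / real N - pi / 2) (pi / real N) c j"
    and s: "2 * R * sin (pi / real N) = s"
    using standing_polygon_of_regular_polygon[OF assms(1-4)] by blast
  then interpret standing_polygon N R "2 * (pi / real N) * (of_int j - 1) + pi / real N - pi / 2" "pi / real N" c j
    by simp
  have m_odd: "N = 2 * m + 1" if "odd N" using that assms(5) by presburger
  have m_even: "N = 2 * m + 2" if "even N" using that assms(1,5) by presburger
  have k_iff: "k \<le> m \<longleftrightarrow> 2 * k < N" for k
    using m_odd m_even by (cases "odd N") linarith+
  have m: "1 \<le> m" "2 * m < N"
    using k_iff[of 1] k_iff[of m] assms(1) by auto
  have range: "{k. 1 \<le> k \<and> 2 * k < N} = {1..m}"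
    by (intro set_eqI) (simp only: mem_Collect_eq atLeastAtMost_iff k_iff)
  have less: "Re (star l) < Re (star k)" if "k < l" "l \<le> m" for k l
    using Re_star_less[of k l] k_iff[of l] that by simp
  have "inj_on star {1..m}"
  proof (rule inj_onI)
    fix k l assume "k \<in> {1..m}" "l \<in> {1..m}" "star k = star l"
    then show "k = l" using less[of k l] less[of l k] by (cases k l rule: linorder_cases) auto
  qed
  then have bij: "bij_betw star {1..m} (star_points c j)"
    unfolding star_points_eq range by (rule inj_on_imp_bij_betw)
  have Re_center: "Re (tile_center k) = Re (star k) - s / 2" if "2 * k < N" for k
    using tile_center_coordinates(1)[OF that] s by (simp add: star_def)
  have tile: "center (tile c j k) = tile_center k" if "k \<in> {1..m}" for k
    using tile_properties(3)[of k] that k_iff[of k] by simp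
  have closure: "closure (step_region c j k) \<inter> extended_forward_edge c j =
      (if k < m then closed_segment (star k) (star (k + 1))
       else {p \<in> extended_forward_edge c j. Re p \<le> Re (star m)})" if "k \<in> {1..m}" for k
  proof (cases "k < m")
    case True
    then show ?thesis using closure_step_region_edge[of k] that k_iff[of k] k_iff[of "k + 1"] by simp
  next
    case False
    then have "k = m" using that by simp
    then show ?thesis using closure_step_region_edge[OF m] k_iff[of "m + 1"] by simp
  qed
  have top: "\<exists>t. top_vertex c t \<and> Im (tile_center m) = Im t" if "odd N"
    using top_vertex_odd[OF m_odd[OF that]] Im_tile_center_last(1)[OF m_odd[OF that]] by metis
  have zero: "Im (tile_center m) = 0" if "even N"
    using Im_tile_center_last(2)[OF m_even[OF that]] .
  have on_line: "center (tile c j k) \<in> affine hull {star 1, tile_center m}"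
    "affine hull {star 1, tile_center m} \<inter> {z. Re z = Re (star k) - s / 2} = {center (tile c j k)}"
    if "k \<in> {1..m}" for k
  proof -
    have k: "1 \<le> k" "2 * k < N" using that k_iff[of k] by simp_all
    show "center (tile c j k) \<in> affine hull {star 1, tile_center m}"
      "affine hull {star 1, tile_center m} \<inter> {z. Re z = Re (star k) - s / 2} = {center (tile c j k)}"
      using centers_line(2,3)[OF m k] by (simp_all only: tile[OF that] Re_center[OF k(2)])
  qed
  have last: "center (tile c j m) = tile_center m" using tile[of m] m by simp
  have line: "let cD = center (tile c j m); L = affine hull {star 1, cD} in
      star 1 \<noteq> cD \<and>
      (\<forall>k \<in> {1..m}. center (tile c j k) \<in> L) \<and>
      (odd N \<longrightarrow> (\<exists>t. top_vertex c t \<and> Im cD = Im t)) \<and>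
      (even N \<longrightarrow> Im cD = 0) \<and>
      (\<forall>k \<in> {1..m}. L \<inter> {z. Re z = Re (star k) - s / 2} = {center (tile c j k)})"
    unfolding Let_def last using centers_line(1)[OF m] on_line top zero by blast
  have regions: "step_region c j k \<in> components (inv_component c j - (\<Union>i. trailing_ext c i)) \<and>
      closure (step_region c j k) \<inter> extended_forward_edge c j =
        (if k < m then closed_segment (star k) (star (k + 1))
         else {p \<in> extended_forward_edge c j. Re p \<le> Re (star m)}) \<and>
      open_convex_polygon (tile c j k) \<and>
      (tau c ^^ N) ` tile c j k = tile c j k \<and>
      Re (center (tile c j k)) = Re (star k) - s / 2" if "k \<in> {1..m}" for k
  proof -
    have k: "1 \<le> k" "2 * k < N" using that k_iff[of k] by simp_all
    show ?thesis
      by (intro conjI step_region_component[OF k] closure[OF that] tile_properties(2,4)[OF k])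
        (simp only: tile[OF that] Re_center[OF k(2)])
  qed
  have "finite (star_points c j)" "card (star_points c j) = m"
    using bij_betw_finite[OF bij] bij_betw_same_card[OF bij] by simp_all
  moreover have "\<forall>k l. 1 \<le> k \<and> k < l \<and> l \<le> m \<longrightarrow> Re (star l) < Re (star k)"
    using less by blast
  ultimately show ?thesis
    using bij star_1 regions line by blast
qed

end
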